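(* Let $\{X_k\}$ be generated by Algorithm ASRGA (described in the context) applied to the problem $\min_{X\in\mathcal M} f(X)$, $f(X)=g(X)+\sum_{i=1}^m[\varphi(h_i(X))]^p$, with smoothing function $\tilde f_\mu$, and let $\{\tilde X_k\}$ be the auxiliary sequence defined in the context. Then: (1) $\{\tilde X_k\}$ has at least one accumulation point, and every accumulation point of $\{\tilde X_k\}$ is a stationary point of the problem. (2) The algorithm reaches an $\epsilon$-approximate stationary point of the problem after at most $O(\epsilon^{p-4})$ iterations; that is, there exist constants $C>0$ and $\epsilon_0>0$, independent of $\epsilon$, such that for every $\epsilon\in(0,\epsilon_0]$ there is an index $j$ with $1\le j\le C\epsilon^{p-4}$ such that the iterate $X_j$ is an $\epsilon$-approximate stationary point of the problem.
   Context: **Problem.** Let $n,s,m$ be positive integers, $p\in(0,1]$, and let $\mathcal M$ be a compact embedded submanifold of $\mathbb R^{n\times s}$. $\mathbb R^{n\times s}$ carries the inner product $\langle A,B\rangle=\mathrm{tr}(A^\top B)$ and Frobenius norm $\|\cdot\|_{\mathrm F}$; each tangent space $\mathcal T_X\mathcal M$ carries the induced inner product. The problem is $$\min_{X\in\mathcal M} f(X):=g(X)+\sum_{i=1}^m[\varphi(h_i(X))]^p .$$ Standing assumptions: $g,h_1,\dots,h_m:\mathbb R^{n\times s}\to\mathbb R$ are continuously differentiable; their Euclidean gradients $\nabla g$ and $\nabla h_i$ are Lipschitz continuous over $\mathcal M$ with constants $L_g\ge0$ and $L_h\ge0$ respectively; $\varphi:\mathbb R\to\mathbb R_+=[0,\infty)$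 is locally Lipschitz continuous. **Smoothing function of $\varphi$.** $\{\tilde\varphi_\mu\}_{\mu>0}$, $\tilde\varphi_\mu:\mathbb R\to\mathbb R_+$, is a fixed family such that: (i) each $\tilde\varphi_\mu$ is continuously differentiable; (ii) there is $\sigma>0$ with $\tilde\varphi_\mu(t)\ge\sigma\mu$ for all $t\in\mathbb R$, $\mu>0$; (iii) $\lim_{s\to t,\,\mu\downarrow0}\tilde\varphi_\mu(s)=\varphi(t)$ for all $t\in\mathbb R$; (iv) there is $\kappa>0$ with $|\tilde\varphi_{\mu_1}(t)-\tilde\varphi_{\mu_2}(t)|\le\kappa|\mu_1-\mu_2|$ for all $t\in\mathbb R$, $\mu_1,\mu_2>0$; (v) there is $M_\varphi>0$ with $|\tilde\varphi_\mu'(t)|\le M_\varphi$ for all $t\in\mathbb R$, $\mu>0$; (vi) there is $L_\varphi>0$ such that for every $\mu>0$, $\tilde\varphi_\mu'$ is Lipschitz continuous on $\mathbb R$ with constant $L_\varphi\mu^{-1}$. The smoothing function of $f$ is $\tilde f_\mu(X)=g(X)+\sum_{i=1}^m[\tilde\varphi_\mu(h_i(X))]^p$, $\mu>0$. Its Riemannian gradient $\mathsf{grad}\,\tilde f_\mu(X)$ at $X\in\mathcal M$ is the orthogonal projection of the Euclidean gradient $\nabla\tilde f_\mu(X)$ onto $\mathcal T_X\mathcal M$. **Retraction.** $\mathscr R:\mathcal T\mathcal M\to\mathcal M$ is a retraction: a smooth map on the tangent bundle whose restriction $\mathscr R_X$ to $\mathcal T_X\mathcal M$ satisfies, for every $X\in\mathcal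 M$, $\mathscr R_X(0_X)=X$ and that the differential of $\mathscr R_X$ at $0_X$ is the identity on $\mathcal T_X\mathcal M$. **Algorithm ASRGA.** Input: $X_0=X_1\in\mathcal M$, $\mu_0\in(0,1]$, $\eta_0>0$. For $k=1,2,\dots$: set $\mu_k=k^{-1/(4-p)}$; define $\eta_k>0$ by $$\eta_k^2=\eta_{k-1}^2+\mu_k^{2-p}\|\mathsf{grad}\,\tilde f_{\mu_k}(X_k)\|_{\mathrm F}^2;$$ and set $$X_{k+1}=\mathscr R_{X_k}\Bigl(-\tfrac{\mu_k^{2-p}}{\eta_k}\,\mathsf{grad}\,\tilde f_{\mu_k}(X_k)\Bigr).$$ **Auxiliary sequence.** For $k\ge1$, choose $N_k\in\arg\min_{j\in\{\lfloor k/2\rfloor,\dots,k\}}\|\mathsf{grad}\,\tilde f_{\mu_j}(X_j)\|_{\mathrm F}$ and set $\tilde X_k=X_{N_k}$, $\tilde\mu_k=\mu_{N_k}$. **Stationarity.** The Riemannian subdifferential of $f$ associated with $\tilde f_\mu$ at $X\in\mathcal M$, denoted $\tilde\partial_{\mathsf R}f(X)$, is the set of all $D\in\mathcal T_X\mathcal M$ that are limits of $\mathsf{grad}\,\tilde f_\mu(Z)$ along some sequence $Z\in\mathcal M$, $Z\to X$, $\mu\downarrow0$. A point $X\in\mathcal M$ is a stationary point of the problem if $0\in\tilde\partial_{\mathsf R}f(X)$, i.e. $\liminf_{\mathcal M\ni Z\to X,\,\mu\downarrow0}\|\mathsf{grad}\,\tilde f_\mu(Z)\|_{\mathrm F}=0$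 (here $Z=X$ is allowed). A point $X\in\mathcal M$ is an $\epsilon$-approximate stationary point if there is $\mu\in(0,\epsilon]$ with $\|\mathsf{grad}\,\tilde f_\mu(X)\|_{\mathrm F}\le\epsilon$. *)

theory Defs
  imports "HOL-Analysis.Analysis"
begin

section \<open>Smooth maps and embedded submanifolds of a Euclidean space\<close>

text \<open>\<open>Ck_on k U f\<close> is meant for open \<open>U\<close>: all iterated directional derivatives of \<open>f\<close>
  up to order \<open>k\<close> exist and are continuous on \<open>U\<close>.\<close>

primrec Ck_on ::
  "nat \<Rightarrow> 'a::real_normed_vector set \<Rightarrow> ('a \<Rightarrow> 'b::real_normed_vector) \<Rightarrow> bool" where
  "Ck_on 0 U f \<longleftrightarrow> continuous_on U f"
| "Ck_on (Suc k) U f \<longleftrightarrow>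
     (\<forall>x\<in>U. f differentiable (at x)) \<and>
     (\<forall>v. Ck_on k U (\<lambda>x. frechet_derivative f (at x) v))"

definition smooth_on ::
  "'a::real_normed_vector set \<Rightarrow> ('a \<Rightarrow> 'b::real_normed_vector) \<Rightarrow> bool" where
  "smooth_on U f \<longleftrightarrow> (\<forall>k. Ck_on k U f)"

text \<open>Smoothness of a map on a subset (not necessarily open) such as a submanifold: the map
  has smooth local extensions to the ambient space.\<close>

definition smooth_map_on ::
  "'a::real_normed_vector set \<Rightarrow> ('a \<Rightarrow> 'b::real_normed_vector) \<Rightarrow> bool" where
  "smooth_map_on S f \<longleftrightarrow>
     (\<forall>x\<in>S. \<exists>U F. open U \<and> x \<in> U \<and> smooth_on U F \<and> (\<forall>y\<in>U \<inter> S. F y = f y))"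

text \<open>Slice charts: around each of its points, \<open>M\<close> is straightened to a piece of a
  \<open>d\<close>-dimensional linear subspace by a diffeomorphism of open subsets of the ambient space.\<close>

definition embedded_submanifold :: "'a::euclidean_space set \<Rightarrow> bool" where
  "embedded_submanifold M \<longleftrightarrow>
     (\<exists>d. \<forall>x\<in>M. \<exists>U (V :: 'a set) \<psi> \<psi>' L. open U \<and> open V \<and> x \<in> U \<and>
        homeomorphism U V \<psi> \<psi>' \<and> smooth_on U \<psi> \<and> smooth_on V \<psi>' \<and>
        subspace L \<and> dim L = d \<and> \<psi> ` (U \<inter> M) = V \<inter> L)"

text \<open>Velocities at \<open>x\<close> of smooth curves in \<open>M\<close>.\<close>

definition tangent_space :: "'a::euclidean_space set \<Rightarrow> 'a \<Rightarrow> 'a set" where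
  "tangent_space M x =
     {v. \<exists>c e. 0 < e \<and> smooth_on {-e<..<e} c \<and> c ` {-e<..<e} \<subseteq> M \<and> c (0::real) = x \<and>
           (c has_vector_derivative v) (at 0)}"

definition tangent_bundle :: "'a::euclidean_space set \<Rightarrow> ('a \<times> 'a) set" where
  "tangent_bundle M = (SIGMA x:M. tangent_space M x)"

text \<open>The derivative of \<open>R x\<close> at \<open>0\<close> is taken within the tangent space only; outside the tangent
  bundle the values of \<open>R\<close> are irrelevant.\<close>

definition manifold_retraction :: "'a::euclidean_space set \<Rightarrow> ('a \<Rightarrow> 'a \<Rightarrow> 'a) \<Rightarrow> bool" where
  "manifold_retraction M R \<longleftrightarrow>
     (\<forall>(x, v)\<in>tangent_bundle M. R x v \<in> M) \<and>
     smooth_map_on (tangent_bundle M) (\<lambda>(x, v). R x v) \<and>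
     (\<forall>x\<in>M. R x 0 = x \<and> (R x has_derivative (\<lambda>v. v)) (at 0 within tangent_space M x))"

section \<open>Gradients\<close>

definition gradient :: "('a::euclidean_space \<Rightarrow> real) \<Rightarrow> 'a \<Rightarrow> 'a" where
  "gradient f x = (THE D. GDERIV f x :> D)"

definition orth_proj :: "'a::euclidean_space set \<Rightarrow> 'a \<Rightarrow> 'a" where
  "orth_proj S v = (THE w. w \<in> S \<and> (\<forall>u\<in>S. orthogonal (v - w) u))"

definition riem_grad :: "'a::euclidean_space set \<Rightarrow> ('a \<Rightarrow> real) \<Rightarrow> 'a \<Rightarrow> 'a" where
  "riem_grad M f x = orth_proj (tangent_space M x) (gradient f x)"

section \<open>The problem and its smoothing\<close>

definition objective ::
  "('a \<Rightarrow> real) \<Rightarrow> (nat \<Rightarrow> 'a \<Rightarrow> real) \<Rightarrow> nat \<Rightarrow> real \<Rightarrow> (real \<Rightarrow> real) \<Rightarrow> 'a \<Rightarrow> real" where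
  "objective g h m p \<phi> X = g X + (\<Sum>i=1..m. \<phi> (h i X) powr p)"

definition smoothed_objective ::
  "('a \<Rightarrow> real) \<Rightarrow> (nat \<Rightarrow> 'a \<Rightarrow> real) \<Rightarrow> nat \<Rightarrow> real \<Rightarrow> (real \<Rightarrow> real \<Rightarrow> real) \<Rightarrow>
     real \<Rightarrow> 'a \<Rightarrow> real" where
  "smoothed_objective g h m p \<phi>s \<mu> = objective g h m p (\<phi>s \<mu>)"

text \<open>\<open>\<phi>s \<mu>\<close> is the smoothing of \<open>\<phi>\<close> with parameter \<open>\<mu>\<close>; only its values for \<open>\<mu> > 0\<close> matter.\<close>

definition smoothing_function :: "(real \<Rightarrow> real) \<Rightarrow> (real \<Rightarrow> real \<Rightarrow> real) \<Rightarrow> bool" where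
  "smoothing_function \<phi> \<phi>s \<longleftrightarrow>
     (\<forall>\<mu>>0. \<forall>t. 0 \<le> \<phi>s \<mu> t) \<and>
     (\<forall>\<mu>>0. \<phi>s \<mu> C1_differentiable_on UNIV) \<and>
     (\<exists>\<sigma>>0. \<forall>t. \<forall>\<mu>>0. \<sigma> * \<mu> \<le> \<phi>s \<mu> t) \<and>
     (\<forall>t. ((\<lambda>(s, \<mu>). \<phi>s \<mu> s) \<longlongrightarrow> \<phi> t) (nhds t \<times>\<^sub>F at_right 0)) \<and>
     (\<exists>\<kappa>>0. \<forall>t. \<forall>\<mu>1>0. \<forall>\<mu>2>0. \<bar>\<phi>s \<mu>1 t - \<phi>s \<mu>2 t\<bar> \<le> \<kappa> * \<bar>\<mu>1 - \<mu>2\<bar>) \<and>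
     (\<exists>M\<^sub>\<phi>>0. \<forall>t. \<forall>\<mu>>0. \<bar>deriv (\<phi>s \<mu>) t\<bar> \<le> M\<^sub>\<phi>) \<and>
     (\<exists>L\<^sub>\<phi>>0. \<forall>\<mu>>0. (L\<^sub>\<phi> / \<mu>)-lipschitz_on UNIV (deriv (\<phi>s \<mu>)))"

text \<open>The smoothed objectives indeed approximate the objective.\<close>

lemma smoothed_objective_tendsto_objective:
  fixes g :: "'a::euclidean_space \<Rightarrow> real"
  assumes "smoothing_function \<phi> \<phi>s" and "0 < p"
    and "continuous_on UNIV g" and "\<And>i. i \<in> {1..m} \<Longrightarrow> continuous_on UNIV (h i)"
  shows "((\<lambda>(Z, \<mu>). smoothed_objective g h m p \<phi>s \<mu> Z) \<longlongrightarrow> objective g h m p \<phi> X)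
           (nhds X \<times>\<^sub>F at_right 0)"
proof -
  let ?F = "nhds X \<times>\<^sub>F at_right (0::real)"
  have fst: "(fst \<longlongrightarrow> X) ?F"
    by (rule filterlim_fst)
  have snd: "filterlim snd (at_right 0) ?F"
    by (rule filterlim_snd)
  have pos: "\<forall>\<^sub>F x in ?F. 0 < snd x"
    using eventually_compose_filterlim[OF eventually_at_right_less snd] .
  have lim: "((\<lambda>(s, \<mu>). \<phi>s \<mu> s) \<longlongrightarrow> \<phi> t) (nhds t \<times>\<^sub>F at_right 0)" for t
    using assms(1) unfolding smoothing_function_def by (elim conjE) (erule spec)
  have nonneg: "0 \<le> \<phi>s \<mu> t" if "0 < \<mu>" for \<mu> t
    using assms(1) that unfolding smoothing_function_def by (elim conjE) simp
  have comp: "((\<lambda>x. u (fst x)) \<longlongrightarrow> u X) ?F" if "continuous_on UNIV u" for u :: "'a \<Rightarrow> real"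
    by (rule continuous_on_tendsto_compose[OF that fst]) simp_all
  have h: "((\<lambda>x. \<phi>s (snd x) (h i (fst x)) powr p) \<longlongrightarrow> \<phi> (h i X) powr p) ?F"
    if i: "i \<in> {1..m}" for i
  proof (rule tendsto_powr'[OF _ tendsto_const])
    have "filterlim (\<lambda>x. (h i (fst x), snd x)) (nhds (h i X) \<times>\<^sub>F at_right 0) ?F"
      by (rule filterlim_Pair[OF comp[OF assms(4)[OF i]] snd])
    from filterlim_compose[OF lim this]
    show "((\<lambda>x. \<phi>s (snd x) (h i (fst x))) \<longlongrightarrow> \<phi> (h i X)) ?F"
      by simp
    have "\<forall>\<^sub>F x in ?F. 0 \<le> \<phi>s (snd x) (h i (fst x))"
      using pos by (rule eventually_mono) (rule nonneg)
    then show "\<phi> (h i X) \<noteq> 0 \<or> 0 < p \<and> (\<forall>\<^sub>F x in ?F. 0 \<le> \<phi>s (snd x) (h i (fst x)))"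
      using assms(2) by blast
  qed
  show ?thesis
    unfolding smoothed_objective_def objective_def case_prod_unfold
    by (intro tendsto_add tendsto_sum comp assms(3) h)
qed

section \<open>Stationarity\<close>

text \<open>\<open>fs \<mu>\<close> is the smoothing of the objective with parameter \<open>\<mu>\<close>.\<close>

definition riem_subdifferential ::
  "'a::euclidean_space set \<Rightarrow> (real \<Rightarrow> 'a \<Rightarrow> real) \<Rightarrow> 'a \<Rightarrow> 'a set" where
  "riem_subdifferential M fs X =
     {D \<in> tangent_space M X. \<exists>Z \<mu>. (\<forall>k. Z k \<in> M) \<and> Z \<longlonglongrightarrow> X \<and>
        filterlim \<mu> (at_right 0) sequentially \<and>
        (\<lambda>k::nat. riem_grad M (fs (\<mu> k)) (Z k)) \<longlonglongrightarrow> D}"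

definition stationary_point ::
  "'a::euclidean_space set \<Rightarrow> (real \<Rightarrow> 'a \<Rightarrow> real) \<Rightarrow> 'a \<Rightarrow> bool" where
  "stationary_point M fs X \<longleftrightarrow> X \<in> M \<and> 0 \<in> riem_subdifferential M fs X"

definition approx_stationary_point ::
  "'a::euclidean_space set \<Rightarrow> (real \<Rightarrow> 'a \<Rightarrow> real) \<Rightarrow> real \<Rightarrow> 'a \<Rightarrow> bool" where
  "approx_stationary_point M fs \<epsilon> X \<longleftrightarrow>
     X \<in> M \<and> (\<exists>\<mu>. 0 < \<mu> \<and> \<mu> \<le> \<epsilon> \<and> norm (riem_grad M (fs \<mu>) X) \<le> \<epsilon>)"

section \<open>The algorithm\<close>

definition ASRGA_run ::
  "'a::euclidean_space set \<Rightarrow> ('a \<Rightarrow> 'a \<Rightarrow> 'a) \<Rightarrow> real \<Rightarrow> (real \<Rightarrow> 'a \<Rightarrow> real) \<Rightarrow>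
     (nat \<Rightarrow> real) \<Rightarrow> (nat \<Rightarrow> real) \<Rightarrow> (nat \<Rightarrow> 'a) \<Rightarrow> bool" where
  "ASRGA_run M R p fs \<mu> \<eta> X \<longleftrightarrow>
     X 0 \<in> M \<and> X 1 = X 0 \<and> 0 < \<mu> 0 \<and> \<mu> 0 \<le> 1 \<and> 0 < \<eta> 0 \<and>
     (\<forall>k\<ge>1.
        \<mu> k = real k powr (- 1 / (4 - p)) \<and>
        0 < \<eta> k \<and>
        (\<eta> k)\<^sup>2 = (\<eta> (k - 1))\<^sup>2 + \<mu> k powr (2 - p) * (norm (riem_grad M (fs (\<mu> k)) (X k)))\<^sup>2 \<and>
        X (k + 1) = R (X k) (- ((\<mu> k powr (2 - p) / \<eta> k) *\<^sub>R riem_grad M (fs (\<mu> k)) (X k))))"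

text \<open>\<open>N k\<close> is any minimiser; it is constrained only for \<open>k \<ge> 1\<close>.\<close>

definition best_index ::
  "'a::euclidean_space set \<Rightarrow> (real \<Rightarrow> 'a \<Rightarrow> real) \<Rightarrow> (nat \<Rightarrow> real) \<Rightarrow> (nat \<Rightarrow> 'a) \<Rightarrow>
     (nat \<Rightarrow> nat) \<Rightarrow> bool" where
  "best_index M fs \<mu> X N \<longleftrightarrow>
     (\<forall>k\<ge>1. is_arg_min (\<lambda>j. norm (riem_grad M (fs (\<mu> j)) (X j))) (\<lambda>j. j \<in> {k div 2..k}) (N k))"

definition accumulation_point :: "(nat \<Rightarrow> 'a::topological_space) \<Rightarrow> 'a \<Rightarrow> bool" where
  "accumulation_point Y x \<longleftrightarrow> (\<exists>r. strict_mono r \<and> (Y \<circ> r) \<longlonglongrightarrow> x)"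

end

theory Submission
  imports Defs
begin

text \<open>Write \<open>w = p - 2\<close>. Because the smoothing stays above \<open>\<sigma> \<mu>\<close>, the map \<open>t \<mapsto> t powr p\<close> is only ever
  evaluated at distance at least \<open>\<sigma> \<mu>\<close> from its singularity at \<open>0\<close>, and the gradient of the smoothed objective is
  Lipschitz on \<open>M\<close> with a constant of order \<open>\<mu> powr w\<close> (\<open>smoothed_objective_bounds\<close>). Along a
  retraction this yields the descent inequality
  \<open>fs \<mu> (R x v) \<le> fs \<mu> x + v \<bullet> gradient (fs \<mu>) x + \<Lambda> * \<mu> powr w * (norm v)\<^sup>2\<close> with one constant \<open>\<Lambda>\<close>
  for all \<open>x\<close>, \<open>v\<close> and \<open>\<mu> \<le> 1\<close>. \<open>M\<close> need not be convex, so the gradient is compared not along the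
  chord from \<open>x\<close> to \<open>R x v\<close> but along the curve \<open>t \<mapsto> R x (t *\<^sub>R v)\<close>, which stays in \<open>M\<close>
  (\<open>retraction_curves\<close>, \<open>retraction_descent\<close>).

  Let \<open>G k\<close> be the Riemannian gradient at step \<open>k\<close> and \<open>a k = \<mu> k powr (2 - p) * (norm (G k))\<^sup>2\<close>, so
  that \<open>(\<eta> k)\<^sup>2 = (\<eta> (k - 1))\<^sup>2 + a k\<close>. For the step taken by the algorithm, the powers of \<open>\<mu> k\<close>
  cancel and the descent inequality reads
  \<open>fs (\<mu> k) (X (k + 1)) \<le> fs (\<mu> k) (X k) - a k / \<eta> k + \<Lambda> * a k / (\<eta> k)\<^sup>2\<close>. Passing from \<open>\<mu> k\<close> to
  \<open>\<mu> (k + 1)\<close> costs at most \<open>C * (\<mu> k powr p - \<mu> (k + 1) powr p)\<close>, which telescopes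
  (\<open>smoothed_objective_parameter_drift\<close>). Hence the potential \<open>fs (\<mu> k) (X k) + C * \<mu> k powr p\<close> falls
  by at least \<open>(\<eta> k - \<eta> (k - 1)) / 2\<close> whenever \<open>\<eta> k\<close> exceeds \<open>2 * \<Lambda>\<close>. It is bounded, so \<open>\<eta>\<close> is
  bounded too (\<open>adaptive_normalization_bounded\<close>), that is, the sum of all \<open>a k\<close> is finite.

  The window from \<open>k div 2\<close> to \<open>k\<close> contains at least \<open>k / 2\<close> indices, each with weight
  \<open>\<mu> j powr (2 - p)\<close> at least \<open>k powr (- (2 - p) / (4 - p))\<close>. A bounded sum therefore forces the
  smallest gradient norm in the window to be of order \<open>k powr (- 1 / (4 - p))\<close>
  (\<open>ASRGA_best_gradient_rate\<close>), the same order as the smoothing parameters there. Both claims are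
  read off from this rate: it tends to \<open>0\<close>, and it drops below \<open>\<epsilon>\<close> once \<open>k\<close> is a suitable
  multiple of \<open>\<epsilon> powr (p - 4)\<close>.\<close>

section \<open>Tangent spaces and gradients\<close>

lemma Ck_on_cong:
  assumes "open U" and "\<And>x. x \<in> U \<Longrightarrow> f x = g x" and "Ck_on k U f"
  shows "Ck_on k U g"
  using assms(2,3)
proof (induction k arbitrary: f g)
  case 0
  then show ?case using continuous_on_cong by fastforce
next
  case (Suc k)
  have iff: "(f has_derivative D) (at x) \<longleftrightarrow> (g has_derivative D) (at x)" if "x \<in> U" for x D
    using has_derivative_transform_within_open[OF _ \<open>open U\<close> that] Suc.prems(1) by metis
  then have eq: "frechet_derivative f (at x) = frechet_derivative g (at x)" if "x \<in> U" for x
    using that unfolding frechet_derivative_def by simp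
  show ?case
    unfolding Ck_on.simps
  proof (intro conjI allI ballI)
    show "g differentiable (at x)" if "x \<in> U" for x
      using Suc.prems(2) that iff unfolding Ck_on.simps differentiable_def by blast
    show "Ck_on k U (\<lambda>x. frechet_derivative g (at x) v)" for v
      by (rule Suc.IH[of "\<lambda>x. frechet_derivative f (at x) v"]) (use Suc.prems eq in auto)
  qed
qed

text \<open>The derivative of the composite in direction \<open>s\<close> is again a map composed with the same line,
  namely the directional derivative of \<open>f\<close> in the fixed direction \<open>s *\<^sub>R l\<close>; so the induction needs
  no chain rule for higher derivatives.\<close>

lemma Ck_on_along_line:
  fixes f :: "'a::real_normed_vector \<Rightarrow> 'b::real_normed_vector" and I :: "real set"
  assumes "open I" and "\<And>t. t \<in> I \<Longrightarrow> a + t *\<^sub>R l \<in> V" and "Ck_on k V f"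
  shows "Ck_on k I (\<lambda>t. f (a + t *\<^sub>R l))"
  using assms(3)
proof (induction k arbitrary: f)
  case 0
  then show ?case
    by (auto intro!: continuous_on_compose2[of V f] continuous_intros assms(2))
next
  case (Suc k)
  have der: "((\<lambda>t. f (a + t *\<^sub>R l)) has_derivative
      (\<lambda>s. frechet_derivative f (at (a + t *\<^sub>R l)) (s *\<^sub>R l))) (at t)" if "t \<in> I" for t
  proof -
    have "(f has_derivative frechet_derivative f (at (a + t *\<^sub>R l))) (at (a + t *\<^sub>R l))"
      using Suc.prems assms(2)[OF that] by (simp add: frechet_derivative_works)
    moreover have "((\<lambda>t. a + t *\<^sub>R l) has_derivative (\<lambda>s. s *\<^sub>R l)) (at t)"
      by (auto intro!: derivative_eq_intros)
    ultimately show ?thesis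
      using has_derivative_compose by fast
  qed
  show ?case
    unfolding Ck_on.simps
  proof (intro conjI allI ballI)
    show "(\<lambda>t. f (a + t *\<^sub>R l)) differentiable (at t)" if "t \<in> I" for t
      using der[OF that] differentiable_def by blast
    fix s
    have "Ck_on k I (\<lambda>t. frechet_derivative f (at (a + t *\<^sub>R l)) (s *\<^sub>R l))"
      using Suc.IH[of "\<lambda>y. frechet_derivative f (at y) (s *\<^sub>R l)"] Suc.prems by simp
    then show "Ck_on k I (\<lambda>t. frechet_derivative (\<lambda>t. f (a + t *\<^sub>R l)) (at t) s)"
      by (rule Ck_on_cong[OF \<open>open I\<close>, rotated])
        (use frechet_derivative_at[OF der] in metis)
  qed
qed

lemma smooth_on_has_derivative:
  assumes "smooth_on U f" and "x \<in> U"
  shows "(f has_derivative frechet_derivative f (at x)) (at x)"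
proof -
  have "Ck_on (Suc 0) U f"
    using assms(1) unfolding smooth_on_def by blast
  then show ?thesis
    using assms(2) by (simp add: frechet_derivative_works)
qed

text \<open>The definition of \<open>Ck_on\<close> gives continuity of each directional derivative, not of the derivative
  as a linear map; bounding the derivative on the finitely many basis vectors is enough for a
  bound on its operator norm.\<close>

lemma C1_locally_lipschitz:
  fixes f :: "'a::euclidean_space \<Rightarrow> 'b::real_normed_vector"
  assumes "open U" and "x \<in> U" and "Ck_on (Suc 0) U f"
  obtains r L where "0 < r" and "cball x r \<subseteq> U" and "L-lipschitz_on (cball x r) f"
proof -
  obtain r where r: "0 < r" "cball x r \<subseteq> U"
    using assms(1,2) open_contains_cball by blast
  have der: "(f has_derivative frechet_derivative f (at y)) (at y within cball x r)"
    if "y \<in> cball x r" for y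
  proof -
    have "f differentiable (at y)"
      using assms(3) r(2) that by auto
    then show ?thesis
      by (simp add: frechet_derivative_works has_derivative_at_withinI)
  qed
  have "\<exists>B. \<forall>y\<in>cball x r. norm (frechet_derivative f (at y) b) \<le> B" for b
  proof -
    have "continuous_on (cball x r) (\<lambda>y. frechet_derivative f (at y) b)"
      using assms(3) by (intro continuous_on_subset[OF _ r(2)]) simp
    then have "bounded ((\<lambda>y. frechet_derivative f (at y) b) ` cball x r)"
      by (intro compact_imp_bounded compact_continuous_image) auto
    then show ?thesis
      unfolding bounded_iff by auto
  qed
  then obtain B where B: "\<And>b y. y \<in> cball x r \<Longrightarrow> norm (frechet_derivative f (at y) b) \<le> B b"
    by metis
  have B0: "0 \<le> B b" for b
    using order_trans[OF norm_ge_zero B[of x b]] r(1) by simp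
  have "onorm (frechet_derivative f (at y)) \<le> (\<Sum>b\<in>Basis. B b)" if "y \<in> cball x r" for y
  proof (rule onorm_le)
    fix v
    have lin: "linear (frechet_derivative f (at y))"
      using der[OF that] has_derivative_linear by blast
    have "norm (frechet_derivative f (at y) v)
        = norm (\<Sum>b\<in>Basis. (v \<bullet> b) *\<^sub>R frechet_derivative f (at y) b)"
      by (subst (1) euclidean_representation[of v, symmetric])
        (simp add: linear_sum[OF lin] linear_cmul[OF lin])
    also have "\<dots> \<le> (\<Sum>b\<in>Basis. norm v * B b)"
      by (intro sum_norm_le) (auto intro!: mult_mono Basis_le_norm B that)
    finally show "norm (frechet_derivative f (at y) v) \<le> (\<Sum>b\<in>Basis. B b) * norm v"
      by (simp add: sum_distrib_left mult.commute)
  qed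
  then have "(\<Sum>b\<in>Basis. B b)-lipschitz_on (cball x r) f"
    by (intro bounded_derivative_imp_lipschitz[OF der]) (auto simp: sum_nonneg B0)
  then show ?thesis
    using that r by blast
qed

text \<open>In a slice chart \<open>M\<close> is a piece of the linear subspace \<open>L\<close>, where the velocities of curves through
  a point are exactly the vectors of \<open>L\<close>: straight lines realise all of them, and a differentiable
  curve in \<open>L\<close> cannot leave \<open>L\<close> to first order.\<close>

lemma tangent_space_eq_chart_image:
  fixes M :: "'a::euclidean_space set" and V :: "'a set"
  assumes "open U" and "open V" and "x \<in> U" and "x \<in> M" and hom: "homeomorphism U V \<psi> \<psi>'"
    and "smooth_on U \<psi>" and "smooth_on V \<psi>'" and "subspace L" and slice: "\<psi> ` (U \<inter> M) = V \<inter> L"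
  shows "tangent_space M x = frechet_derivative \<psi>' (at (\<psi> x)) ` L"
proof -
  let ?D = "frechet_derivative \<psi> (at x)" and ?D' = "frechet_derivative \<psi>' (at (\<psi> x))"
  have \<psi>x: "\<psi> x \<in> V" "\<psi> x \<in> L" and inv: "\<And>y. y \<in> U \<Longrightarrow> \<psi>' (\<psi> y) = y"
    using slice hom assms(3,4) unfolding homeomorphism_def by auto
  have D: "(\<psi> has_derivative ?D) (at x)" and D': "(\<psi>' has_derivative ?D') (at (\<psi> x))"
    using smooth_on_has_derivative assms(3,6,7) \<psi>x(1) by blast+
  have in_M: "\<psi>' z \<in> M" if "z \<in> V \<inter> L" for z
  proof -
    have "z \<in> \<psi> ` (U \<inter> M)"
      using that slice by simp
    then show ?thesis using inv by auto
  qed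
  show ?thesis
  proof (intro subset_antisym subsetI)
    fix v assume "v \<in> tangent_space M x"
    then obtain c e where c: "0 < e" "c ` {-e<..<e} \<subseteq> M" "c 0 = x"
      "(c has_vector_derivative v) (at 0)" "smooth_on {-e<..<e} c"
      unfolding tangent_space_def by auto
    have \<psi>c: "((\<lambda>t. \<psi> (c t)) has_vector_derivative ?D v) (at 0)"
      using vector_derivative_diff_chain_within[of c v 0 UNIV \<psi> ?D] c(3,4) D
      by (simp add: o_def has_derivative_at_withinI)
    have "(c \<longlongrightarrow> c 0) (nhds 0)"
      using has_vector_derivative_continuous[OF c(4)]
      by (simp add: continuous_within tendsto_at_iff_tendsto_nhds)
    then have "\<forall>\<^sub>F t in nhds 0. c t \<in> U"
      by (rule topological_tendstoD) (use assms(1,3) c(3) in auto)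
    moreover have "\<forall>\<^sub>F t::real in nhds 0. t \<in> {-e<..<e}"
      using c(1) by (intro eventually_nhds_in_open) auto
    ultimately have \<psi>c_in_L: "\<forall>\<^sub>F t in nhds 0. \<psi> (c t) \<in> L"
      by eventually_elim (use slice c(2) in blast)
    have "span L = L"
      using assms(8) by (simp add: span_eq_iff)
    then obtain y z where yz: "y \<in> L" "\<And>w. w \<in> L \<Longrightarrow> orthogonal z w" "?D v = y + z"
      by (metis orthogonal_subspace_decomp_exists[of L "?D v"])
    \<comment> \<open>The component of the velocity orthogonal to \<open>L\<close> is the derivative of a function that vanishes near \<open>0\<close>.\<close>
    have "((\<lambda>t. z \<bullet> \<psi> (c t)) has_real_derivative z \<bullet> ?D v) (at 0)"
      using bounded_linear.has_vector_derivative[OF bounded_linear_inner_right \<psi>c, of z]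
      by (simp add: has_real_derivative_iff_has_vector_derivative)
    moreover have "\<forall>\<^sub>F t in nhds 0. z \<bullet> \<psi> (c t) = 0"
      using \<psi>c_in_L by eventually_elim (use yz(2) in \<open>simp add: orthogonal_def\<close>)
    then have "((\<lambda>t. z \<bullet> \<psi> (c t)) has_real_derivative 0) (at 0)"
      using DERIV_cong_ev[OF refl _ refl, of "\<lambda>t. z \<bullet> \<psi> (c t)" "\<lambda>_. 0"] by simp
    ultimately have "z \<bullet> ?D v = 0"
      by (rule DERIV_unique)
    then have "z = 0"
      using yz by (simp add: inner_add_right orthogonal_def)
    then have "?D v \<in> L"
      using yz by simp
    moreover have "v = ?D' (?D v)"
    proof -
      have "((\<lambda>y. \<psi>' (\<psi> y)) has_derivative (\<lambda>v. ?D' (?D v))) (at x)"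
        by (rule has_derivative_compose[OF D D'])
      moreover have "((\<lambda>y. \<psi>' (\<psi> y)) has_derivative (\<lambda>v. v)) (at x)"
        by (rule has_derivative_transform_within_open[OF has_derivative_ident assms(1,3)])
          (simp add: inv)
      ultimately have "(\<lambda>v. ?D' (?D v)) = (\<lambda>v. v)"
        by (rule has_derivative_unique)
      from fun_cong[OF this, of v] show ?thesis by simp
    qed
    ultimately show "v \<in> ?D' ` L" by blast
  next
    fix w assume "w \<in> ?D' ` L"
    then obtain l where l: "l \<in> L" "w = ?D' l" by blast
    define c where "c = (\<lambda>t. \<psi>' (\<psi> x + t *\<^sub>R l))"
    have "open ((\<lambda>t::real. \<psi> x + t *\<^sub>R l) -` V)"
      by (intro open_vimage assms(2) continuous_intros)
    moreover have "0 \<in> (\<lambda>t::real. \<psi> x + t *\<^sub>R l) -` V"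
      using \<psi>x by simp
    ultimately obtain e where e: "0 < e" "ball 0 e \<subseteq> (\<lambda>t::real. \<psi> x + t *\<^sub>R l) -` V"
      using open_contains_ball by blast
    then have V: "\<psi> x + t *\<^sub>R l \<in> V" if "t \<in> {-e<..<e}" for t
    proof -
      have "t \<in> ball 0 e" using that by (auto simp: abs_less_iff)
      then show ?thesis using e(2) by blast
    qed
    have "smooth_on {-e<..<e} c"
      unfolding smooth_on_def c_def
      by (intro allI Ck_on_along_line[where V = V] V)
        (use assms(7) in \<open>auto simp: smooth_on_def\<close>)
    moreover have "c ` {-e<..<e} \<subseteq> M"
      unfolding c_def by (intro image_subsetI in_M IntI V subspace_add subspace_scale \<psi>x(2) l(1) assms(8))
    moreover have "c 0 = x"
      using inv assms(3) by (simp add: c_def)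
    moreover have "(c has_vector_derivative w) (at 0)"
    proof -
      have "((\<lambda>t. \<psi> x + t *\<^sub>R l) has_vector_derivative l) (at 0)"
        by (auto intro!: derivative_eq_intros)
      then show ?thesis
        using vector_derivative_diff_chain_within[of "\<lambda>t. \<psi> x + t *\<^sub>R l" l 0 UNIV \<psi>' ?D'] D' l(2)
        by (simp add: o_def c_def has_derivative_at_withinI)
    qed
    ultimately show "w \<in> tangent_space M x"
      unfolding tangent_space_def using e(1) by blast
  qed
qed

text \<open>Velocities of curves do not visibly form a vector space; linearity comes from the chart. It is
  what makes the orthogonal projection in the Riemannian gradient well defined.\<close>

lemma subspace_tangent_space:
  fixes M :: "'a::euclidean_space set"
  assumes "embedded_submanifold M" and "x \<in> M"
  shows "subspace (tangent_space M x)"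
proof -
  obtain U L and V :: "'a set" and \<psi> \<psi>' where ch: "open U" "open V" "x \<in> U" "homeomorphism U V \<psi> \<psi>'"
    "smooth_on U \<psi>" "smooth_on V \<psi>'" "subspace L" "\<psi> ` (U \<inter> M) = V \<inter> L"
    using assms unfolding embedded_submanifold_def by blast
  have "\<psi> x \<in> V" using ch(3,4) unfolding homeomorphism_def by auto
  then have "linear (frechet_derivative \<psi>' (at (\<psi> x)))"
    using smooth_on_has_derivative[OF ch(6)] has_derivative_linear by blast
  then show ?thesis
    unfolding tangent_space_eq_chart_image[OF ch(1,2,3) assms(2) ch(4-8)]
    using ch(7) by (rule linear_subspace_image)
qed

lemma orth_proj_props:
  fixes S :: "'a::euclidean_space set"
  assumes "subspace S"
  shows "orth_proj S v \<in> S" and "\<And>u. u \<in> S \<Longrightarrow> u \<bullet> orth_proj S v = u \<bullet> v"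
proof -
  have span: "span S = S"
    using assms by (simp add: span_eq_iff)
  obtain y z where yz: "y \<in> S" "\<And>w. w \<in> S \<Longrightarrow> orthogonal z w" "v = y + z"
    by (metis orthogonal_subspace_decomp_exists[of S v] span)
  let ?P = "\<lambda>w. w \<in> S \<and> (\<forall>u\<in>S. orthogonal (v - w) u)"
  have "?P (orth_proj S v)"
    unfolding orth_proj_def
  proof (rule theI[of ?P])
    show "?P y"
      using yz by simp
    fix w assume w: "?P w"
    have "w - y \<in> S"
      using w yz(1) assms by (simp add: subspace_diff)
    then have "(v - w) \<bullet> (w - y) = 0" "z \<bullet> (w - y) = 0"
      using w yz(2) by (auto simp: orthogonal_def)
    then have "(w - y) \<bullet> (w - y) = 0"
      using yz(3) by (simp add: algebra_simps)
    then show "w = y"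
      by simp
  qed
  then show "orth_proj S v \<in> S" and "\<And>u. u \<in> S \<Longrightarrow> u \<bullet> orth_proj S v = u \<bullet> v"
    by (auto simp: orthogonal_def inner_diff_left inner_diff_right inner_commute)
qed

lemma gradient_eq:
  fixes f :: "'a::euclidean_space \<Rightarrow> real"
  assumes "GDERIV f x :> D"
  shows "gradient f x = D"
  unfolding gradient_def
proof (rule the_equality[of "\<lambda>D. GDERIV f x :> D", OF assms])
  fix E assume "GDERIV f x :> E"
  then have "(\<lambda>h. h \<bullet> E) = (\<lambda>h. h \<bullet> D)"
    using assms has_derivative_unique unfolding gderiv_def by blast
  then show "E = D"
    by (metis euclidean_eq_iff inner_commute)
qed

lemma differentiable_GDERIV_gradient:
  fixes f :: "'a::euclidean_space \<Rightarrow> real"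
  assumes "f differentiable (at x)"
  shows "GDERIV f x :> gradient f x"
proof -
  obtain f' where f': "(f has_derivative f') (at x)"
    using assms unfolding differentiable_def by blast
  let ?D = "\<Sum>b\<in>Basis. f' b *\<^sub>R b"
  have lin: "linear f'"
    using f' has_derivative_linear by blast
  have "f' v = v \<bullet> ?D" for v
  proof -
    have "f' v = (\<Sum>b\<in>Basis. (v \<bullet> b) * f' b)"
      by (subst (1) euclidean_representation[of v, symmetric])
        (simp add: linear_sum[OF lin] linear_cmul[OF lin])
    then show ?thesis
      by (simp add: inner_sum_right mult.commute)
  qed
  then have "f' = (\<lambda>v. v \<bullet> ?D)"
    by blast
  with f' have "GDERIV f x :> ?D"
    unfolding gderiv_def by simp
  then show ?thesis
    using gradient_eq by metis
qed

text \<open>Moving along the Riemannian gradient changes the function to first order as fast as the squared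
  norm of that gradient, although the derivative involves the Euclidean one.\<close>

lemma riem_grad_tangent:
  assumes "subspace (tangent_space M x)"
  shows "riem_grad M f x \<in> tangent_space M x"
    and "riem_grad M f x \<bullet> gradient f x = (norm (riem_grad M f x))\<^sup>2"
  unfolding riem_grad_def
  using orth_proj_props(1)[OF assms] orth_proj_props(2)[OF assms orth_proj_props(1)[OF assms]]
  by (simp_all add: power2_norm_eq_inner)

section \<open>Descent along a retraction\<close>

text \<open>Near \<open>(x, 0)\<close> the retraction extends to a smooth map \<open>F\<close> of an open set. Its partial derivatives in
  the second argument are locally Lipschitz, and at \<open>0\<close> the derivative of the retraction is the
  identity, so after time \<open>t\<close> the velocity of \<open>t \<mapsto> R x (t *\<^sub>R v)\<close> has changed by at most a multiple of
  \<open>norm (t *\<^sub>R v) * norm v\<close>. Compactness of \<open>M\<close> makes the constants uniform.\<close>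

lemma retraction_curves:
  fixes M :: "'a::euclidean_space set"
  assumes "compact M" and sub: "\<And>x. x \<in> M \<Longrightarrow> subspace (tangent_space M x)"
    and R: "manifold_retraction M R"
  obtains \<delta> B where "0 < \<delta>" and "0 \<le> B"
    and "\<And>x v. x \<in> M \<Longrightarrow> v \<in> tangent_space M x \<Longrightarrow> norm v \<le> \<delta> \<Longrightarrow>
      \<exists>c'. \<forall>t\<in>{0..1}. ((\<lambda>t. R x (t *\<^sub>R v)) has_vector_derivative c' t) (at t within {0..1}) \<and>
        norm (c' t - v) \<le> B * (norm v)\<^sup>2"
proof -
  define good where "good \<delta> B x \<longleftrightarrow> (\<forall>v\<in>tangent_space M x. norm v \<le> \<delta> \<longrightarrow>
      (\<exists>c'. \<forall>t\<in>{0..1}. ((\<lambda>t. R x (t *\<^sub>R v)) has_vector_derivative c' t) (at t within {0..1}) \<and>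
        norm (c' t - v) \<le> B * (norm v)\<^sup>2))" for \<delta> B :: real and x
  have mono: "good \<delta>' B' x" if "good \<delta> B x" "\<delta>' \<le> \<delta>" "B \<le> B'" for \<delta> \<delta>' B B' x
  proof -
    have "B * (norm v)\<^sup>2 \<le> B' * (norm v)\<^sup>2" for v :: 'a
      using that(3) by (simp add: mult_right_mono)
    then show ?thesis
      using that(1,2) unfolding good_def by (meson order_trans)
  qed
  have local: "\<exists>r>0. \<exists>\<delta>>0. \<exists>B. \<forall>y\<in>M \<inter> ball x r. good \<delta> B y" if x: "x \<in> M" for x
  proof -
    have "(x, 0) \<in> tangent_bundle M"
      using sub[OF x] x by (simp add: tangent_bundle_def subspace_0)
    then obtain U F where F: "open U" "(x, 0) \<in> U" "smooth_on U F"
      "\<And>z. z \<in> U \<inter> tangent_bundle M \<Longrightarrow> F z = (case z of (y, v) \<Rightarrow> R y v)"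
      using R unfolding manifold_retraction_def smooth_map_on_def by blast
    define G where "G b z = frechet_derivative F (at z) (0, b)" for b z
    have "\<exists>r L. 0 < r \<and> cball (x, 0) r \<subseteq> U \<and> L-lipschitz_on (cball (x, 0) r) (G b)" for b
    proof -
      have "Ck_on (Suc (Suc 0)) U F"
        using F(3) unfolding smooth_on_def by blast
      then have "Ck_on (Suc 0) U (G b)"
        unfolding G_def by (subst (asm) Ck_on.simps(2)) blast
      then show ?thesis
        using C1_locally_lipschitz[OF F(1,2)] by metis
    qed
    then obtain r L where rL: "\<And>b. 0 < r b" "\<And>b. cball (x, 0) (r b) \<subseteq> U"
      "\<And>b. (L b)-lipschitz_on (cball (x, 0) (r b)) (G b)"
      by metis
    \<comment> \<open>A radius on which the partial derivatives in all basis directions are Lipschitz; half of it is left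
      for the base point and half for the tangent vector.\<close>
    define \<rho> where "\<rho> = Min (r ` Basis)"
    have \<rho>: "0 < \<rho>" "\<And>b. b \<in> Basis \<Longrightarrow> \<rho> \<le> r b"
      unfolding \<rho>_def using rL(1) by auto
    obtain b0 :: 'a where b0: "b0 \<in> Basis" using nonempty_Basis by blast
    let ?K = "cball (x, 0) \<rho> :: ('a \<times> 'a) set"
    have K: "?K \<subseteq> U"
      using rL(2)[of b0] subset_cball[OF \<rho>(2)[OF b0]] by blast
    have lip: "norm (G b z - G b w) \<le> L b * dist z w" if "b \<in> Basis" "z \<in> ?K" "w \<in> ?K" for b z w
      using lipschitz_onD[OF rL(3)[of b], of z w] that \<rho>(2)[OF that(1)] by (simp add: dist_norm)
    have Lnn: "0 \<le> L b" for b
      using rL(3) lipschitz_on_nonneg by blast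
    have der: "(F has_derivative frechet_derivative F (at z)) (at z)" if "z \<in> ?K" for z
      using smooth_on_has_derivative[OF F(3)] K that by blast
    have expand: "frechet_derivative F (at z) (0, v) = (\<Sum>b\<in>Basis. (v \<bullet> b) *\<^sub>R G b z)"
      if "z \<in> ?K" for z and v :: 'a
    proof -
      have lin: "linear (frechet_derivative F (at z))"
        using der[OF that] has_derivative_linear by blast
      have "(0, v) = (\<Sum>b\<in>Basis. (v \<bullet> b) *\<^sub>R (0::'a, b))"
        by (simp add: prod_eq_iff fst_sum snd_sum euclidean_representation)
      then have "frechet_derivative F (at z) (0, v)
          = frechet_derivative F (at z) (\<Sum>b\<in>Basis. (v \<bullet> b) *\<^sub>R (0::'a, b))"
        by (rule arg_cong)
      also have "\<dots> = (\<Sum>b\<in>Basis. (v \<bullet> b) *\<^sub>R G b z)"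
        unfolding G_def linear_sum[OF lin] linear_cmul[OF lin] ..
      finally show ?thesis .
    qed
    have "good (\<rho> / 2) (\<Sum>b\<in>Basis. L b) y" if y: "y \<in> M" "y \<in> ball x (\<rho> / 2)" for y
      unfolding good_def
    proof (intro ballI impI)
      fix v assume v: "v \<in> tangent_space M y" "norm v \<le> \<rho> / 2"
      let ?c' = "\<lambda>t::real. frechet_derivative F (at (y, t *\<^sub>R v)) (0, v)"
      have inK: "(y, t *\<^sub>R v) \<in> ?K" if "\<bar>t\<bar> \<le> 1" for t
      proof -
        have "dist (x, 0) (y, t *\<^sub>R v) \<le> dist x y + norm (t *\<^sub>R v)"
          using sqrt_sum_squares_le_sum[of "dist x y" "norm (t *\<^sub>R v)"]
          by (simp add: dist_Pair_Pair)
        also have "norm (t *\<^sub>R v) \<le> norm v"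
          using that by (simp add: mult_left_le_one_le)
        also have "dist x y + norm v \<le> \<rho>"
          using y(2) v(2) by simp
        finally show ?thesis by simp
      qed
      have tangent: "t *\<^sub>R v \<in> tangent_space M y" for t
        using sub[OF y(1)] v(1) by (rule subspace_scale)
      have FR: "F (y, t *\<^sub>R v) = R y (t *\<^sub>R v)" if "\<bar>t\<bar> \<le> 1" for t
        using F(4)[of "(y, t *\<^sub>R v)"] K inK[OF that] tangent y(1) by (auto simp: tangent_bundle_def)
      have F': "((\<lambda>t. F (y, t *\<^sub>R v)) has_vector_derivative ?c' t) (at t)" if "\<bar>t\<bar> \<le> 1" for t
      proof -
        have "((\<lambda>t. (y, t *\<^sub>R v)) has_vector_derivative (0, v)) (at t)"
          by (auto intro!: derivative_eq_intros has_vector_derivative_Pair)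
        then show ?thesis
          using vector_derivative_diff_chain_within[of "\<lambda>t. (y, t *\<^sub>R v)" "(0, v)" t UNIV F]
            der[OF inK[OF that]] by (simp add: o_def has_derivative_at_withinI)
      qed
      have c': "((\<lambda>t. R y (t *\<^sub>R v)) has_vector_derivative ?c' t) (at t within {0..1})"
        if "t \<in> {0..1}" for t
        by (rule has_vector_derivative_transform[OF that _ has_vector_derivative_at_within[OF F']])
          (use FR that in auto)
      \<comment> \<open>Here \<open>F\<close> agrees with \<open>R\<close> only on the tangent bundle, so its derivative is known only in the tangent
        direction \<open>v\<close>.\<close>
      have "?c' 0 = v"
      proof -
        have "(R y has_derivative (\<lambda>v. v)) (at 0 within tangent_space M y)"
          using R y(1) unfolding manifold_retraction_def by blast
        then have "((R y \<circ> (\<lambda>t. t *\<^sub>R v)) has_vector_derivative v) (at 0 within {0..1})"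
          by (intro vector_derivative_diff_chain_within)
            (auto intro!: derivative_eq_intros intro: has_derivative_subset simp: tangent image_subset_iff)
        then have "((\<lambda>t. R y (t *\<^sub>R v)) has_vector_derivative v) (at 0 within {0..1})"
          by (simp add: o_def)
        then show ?thesis
          using vector_derivative_unique_within_closed_interval[of 0 1 0 _ "?c' 0" v] c'[of 0] by simp
      qed
      have bound: "norm (?c' t - v) \<le> (\<Sum>b\<in>Basis. L b) * (norm v)\<^sup>2" if "t \<in> {0..1}" for t
      proof -
        have t: "\<bar>t\<bar> \<le> 1" using that by auto
        have "?c' t - ?c' 0 = (\<Sum>b\<in>Basis. (v \<bullet> b) *\<^sub>R (G b (y, t *\<^sub>R v) - G b (y, 0)))"
          using expand[OF inK[OF t]] expand[OF inK[of 0]]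
          by (simp add: scaleR_right_diff_distrib sum_subtractf)
        also have "norm \<dots> \<le> (\<Sum>b\<in>Basis. norm v * (L b * norm v))"
        proof (rule sum_norm_le)
          fix b :: 'a assume b: "b \<in> Basis"
          have "norm (G b (y, t *\<^sub>R v) - G b (y, 0)) \<le> L b * dist (y, t *\<^sub>R v) (y, 0)"
            using lip[OF b inK[OF t] inK[of 0]] by simp
          also have "dist (y, t *\<^sub>R v) (y, 0) \<le> norm v"
            using t by (simp add: dist_Pair_Pair mult_left_le_one_le)
          finally have "norm (G b (y, t *\<^sub>R v) - G b (y, 0)) \<le> L b * norm v"
            using Lnn[of b] by (simp add: mult_left_mono)
          then show "norm ((v \<bullet> b) *\<^sub>R (G b (y, t *\<^sub>R v) - G b (y, 0))) \<le> norm v * (L b * norm v)"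
            using Basis_le_norm[OF b, of v] by (auto intro!: mult_mono)
        qed
        also have "\<dots> = (\<Sum>b\<in>Basis. L b) * (norm v)\<^sup>2"
          unfolding sum_distrib_right by (simp add: power2_eq_square mult_ac)
        finally show ?thesis
          using \<open>?c' 0 = v\<close> by simp
      qed
      show "\<exists>c'. \<forall>t\<in>{0..1}. ((\<lambda>t. R y (t *\<^sub>R v)) has_vector_derivative c' t) (at t within {0..1}) \<and>
        norm (c' t - v) \<le> (\<Sum>b\<in>Basis. L b) * (norm v)\<^sup>2"
        by (intro exI[of _ ?c'] ballI conjI c' bound)
    qed
    then show ?thesis
      using \<rho>(1) by (metis IntE half_gt_zero)
  qed
  then obtain r d B where loc: "\<And>x. x \<in> M \<Longrightarrow> 0 < r x" "\<And>x. x \<in> M \<Longrightarrow> 0 < d x"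
    "\<And>x y. x \<in> M \<Longrightarrow> y \<in> M \<inter> ball x (r x) \<Longrightarrow> good (d x) (B x) y"
    by metis
  obtain C where C: "C \<subseteq> M" "finite C" "M \<subseteq> (\<Union>x\<in>C. ball x (r x))"
    using compactE_image[OF \<open>compact M\<close>, of M "\<lambda>x. ball x (r x)"] loc(1) by force
  \<comment> \<open>The inserted \<open>1\<close> covers the case that \<open>M\<close> and hence \<open>C\<close> is empty; the \<open>0\<close> also keeps \<open>B'\<close> nonnegative.\<close>
  define \<delta> where "\<delta> = Min (insert 1 (d ` C))"
  define B' where "B' = Max (insert 0 (B ` C))"
  show ?thesis
  proof (rule that[of \<delta> B'])
    show "0 < \<delta>" "0 \<le> B'"
      unfolding \<delta>_def B'_def using C(1,2) loc(2) by auto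
    have "good \<delta> B' y" if y: "y \<in> M" for y
    proof -
      obtain x where x: "x \<in> C" "y \<in> ball x (r x)"
        using C(3) y by blast
      have "\<delta> \<le> d x" "B x \<le> B'"
        unfolding \<delta>_def B'_def using C(2) x(1) by auto
      with loc(3)[of x y] x y C(1) show ?thesis
        by (meson IntI mono subsetD)
    qed
    then show "\<exists>c'. \<forall>t\<in>{0..1}. ((\<lambda>t. R x (t *\<^sub>R v)) has_vector_derivative c' t) (at t within {0..1}) \<and>
        norm (c' t - v) \<le> B' * (norm v)\<^sup>2"
      if "x \<in> M" "v \<in> tangent_space M x" "norm v \<le> \<delta>" for x v
      using that unfolding good_def by blast
  qed
qed

text \<open>The constant depends on \<open>M\<close> and \<open>R\<close> only, so it serves all smoothing parameters at once. For short
  \<open>v\<close> the mean value theorem along the curve \<open>t \<mapsto> R x (t *\<^sub>R v)\<close> in \<open>M\<close> compares the gradients at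
  two points of \<open>M\<close>, the only place where they are assumed Lipschitz. For long \<open>v\<close> the boundedness
  of \<open>f\<close> and \<open>f'\<close> suffices, since \<open>(norm v)\<^sup>2\<close> is bounded below.\<close>

lemma retraction_descent:
  fixes M :: "'a::euclidean_space set"
  assumes "compact M" and sub: "\<And>x. x \<in> M \<Longrightarrow> subspace (tangent_space M x)"
    and R: "manifold_retraction M R"
  obtains A where "0 < A"
    and "\<And>f f' K. K-lipschitz_on M f' \<Longrightarrow>
      \<forall>y\<in>M. GDERIV f y :> f' y \<and> \<bar>f y\<bar> \<le> K \<and> norm (f' y) \<le> K \<Longrightarrow>
      \<forall>x\<in>M. \<forall>v\<in>tangent_space M x. f (R x v) \<le> f x + v \<bullet> f' x + A * K * (norm v)\<^sup>2"
proof -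
  obtain \<delta> B where \<delta>: "0 < \<delta>" and B: "0 \<le> B"
    and curve: "\<And>x v. x \<in> M \<Longrightarrow> v \<in> tangent_space M x \<Longrightarrow> norm v \<le> \<delta> \<Longrightarrow>
      \<exists>c'. \<forall>t\<in>{0..1}. ((\<lambda>t. R x (t *\<^sub>R v)) has_vector_derivative c' t) (at t within {0..1}) \<and>
        norm (c' t - v) \<le> B * (norm v)\<^sup>2"
    using retraction_curves[OF assms] by metis
  \<comment> \<open>\<open>A1\<close> serves tangent vectors of norm at most \<open>\<delta>\<close>, and \<open>A2\<close> serves the longer ones.\<close>
  define A1 where "A1 = (1 + B * \<delta>)\<^sup>2 + B"
  define A2 where "A2 = 2 / \<delta>\<^sup>2 + 1 / \<delta>"
  have A1: "0 < A1" and A2: "0 < A2"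
  proof -
    have "0 < 1 + B * \<delta>" using \<delta> B by (simp add: add_pos_nonneg)
    then show "0 < A1" unfolding A1_def using B by (simp add: add_pos_nonneg)
    show "0 < A2" unfolding A2_def using \<delta> by (simp add: add_pos_pos)
  qed
  show ?thesis
  proof (rule that[of "A1 + A2"])
    show "0 < A1 + A2"
      using A1 A2 by simp
    fix f :: "'a \<Rightarrow> real" and f' K
    assume lip: "K-lipschitz_on M f'"
      and bounds: "\<forall>y\<in>M. GDERIV f y :> f' y \<and> \<bar>f y\<bar> \<le> K \<and> norm (f' y) \<le> K"
    then have f': "\<And>y. y \<in> M \<Longrightarrow> GDERIV f y :> f' y"
      and fK: "\<And>y. y \<in> M \<Longrightarrow> \<bar>f y\<bar> \<le> K" and f'K: "\<And>y. y \<in> M \<Longrightarrow> norm (f' y) \<le> K"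
      by blast+
    show "\<forall>x\<in>M. \<forall>v\<in>tangent_space M x. f (R x v) \<le> f x + v \<bullet> f' x + (A1 + A2) * K * (norm v)\<^sup>2"
    proof (intro ballI)
      fix x v assume x: "x \<in> M" and v: "v \<in> tangent_space M x"
      have K: "0 \<le> K"
        using lip lipschitz_on_nonneg by blast
      have in_M: "R x (t *\<^sub>R v) \<in> M" for t
        using R x v subspace_scale[OF sub[OF x]]
        unfolding manifold_retraction_def tangent_bundle_def by auto
      have "f (R x v) \<le> f x + v \<bullet> f' x + (if norm v \<le> \<delta> then A1 else A2) * K * (norm v)\<^sup>2"
      proof (cases "norm v \<le> \<delta>")
        case True
        define c where "c t = R x (t *\<^sub>R v)" for t
        obtain c' where c: "\<And>t. t \<in> {0..1} \<Longrightarrow> (c has_vector_derivative c' t) (at t within {0..1})"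
          and c': "\<And>t. t \<in> {0..1} \<Longrightarrow> norm (c' t - v) \<le> B * (norm v)\<^sup>2"
          using curve[OF x v True] unfolding c_def by blast
        let ?l = "(1 + B * \<delta>) * norm v"
        have c'_le: "norm (c' t) \<le> ?l" if "t \<in> {0..1}" for t
        proof -
          have "norm (c' t) \<le> norm v + norm (c' t - v)"
            by (rule norm_triangle_sub)
          also have "\<dots> \<le> norm v + B * (norm v)\<^sup>2"
            using c'[OF that] by simp
          also have "B * (norm v)\<^sup>2 \<le> B * (\<delta> * norm v)"
            unfolding power2_eq_square using True B by (intro mult_left_mono mult_right_mono) auto
          finally show ?thesis
            by (simp add: algebra_simps)
        qed
        have c0: "c 0 = x" and c1: "c 1 = R x v"
          using R x unfolding manifold_retraction_def c_def by auto
        have "((\<lambda>t. f (c t)) has_derivative (\<lambda>s. s * (c' t \<bullet> f' (c t)))) (at t within {0..1})"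
          if "t \<in> {0..1}" for t
        proof -
          have "(f has_derivative (\<lambda>h. h \<bullet> f' (c t))) (at (c t) within c ` {0..1})"
            using f'[OF in_M[of t]] unfolding gderiv_def c_def[symmetric]
            by (rule has_derivative_at_withinI)
          from has_derivative_in_compose[OF c[OF that, unfolded has_vector_derivative_def] this]
          show ?thesis by simp
        qed
        then obtain \<tau> where \<tau>: "\<tau> \<in> {0<..<1}" "f (c 1) - f (c 0) = c' \<tau> \<bullet> f' (c \<tau>)"
          using mvt_simple[of 0 1 "\<lambda>t. f (c t)" "\<lambda>t s. s * (c' t \<bullet> f' (c t))"] by auto
        have \<tau>01: "\<tau> \<in> {0..1}" using \<tau>(1) by auto
        have "norm (c \<tau> - c 0) \<le> ?l * norm (\<tau> - 0)"
        proof (rule differentiable_bound[of "{0..1}" c "\<lambda>t s. s *\<^sub>R c' t"])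
          show "onorm (\<lambda>s. s *\<^sub>R c' t) \<le> ?l" if "t \<in> {0..1}" for t
            using c'_le[OF that] by (simp add: onorm_scaleR_left onorm_id)
        qed (use c \<tau>01 in \<open>auto simp: has_vector_derivative_def\<close>)
        also have "\<dots> \<le> ?l"
          using \<tau>01 B \<delta> by (intro mult_left_le) auto
        finally have "norm (c \<tau> - x) \<le> ?l"
          using c0 by simp
        then have f'_diff: "norm (f' (c \<tau>) - f' x) \<le> K * ?l"
          using order_trans[OF lipschitz_onD[OF lip in_M[of \<tau>] x, unfolded dist_norm]
              mult_left_mono[OF _ K]] unfolding c_def[symmetric] by simp
        have "f (R x v) - f x - v \<bullet> f' x = (c' \<tau> - v) \<bullet> f' x + c' \<tau> \<bullet> (f' (c \<tau>) - f' x)"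
          using \<tau>(2) c0 c1 by (simp add: inner_diff_left inner_diff_right)
        also have "\<dots> \<le> norm (c' \<tau> - v) * norm (f' x) + norm (c' \<tau>) * norm (f' (c \<tau>) - f' x)"
          by (intro add_mono norm_cauchy_schwarz)
        also have "\<dots> \<le> (B * (norm v)\<^sup>2) * K + ?l * (K * ?l)"
          using c'[OF \<tau>01] f'K[OF x] c'_le[OF \<tau>01] f'_diff B \<delta> by (intro add_mono mult_mono) auto
        also have "\<dots> = A1 * K * (norm v)\<^sup>2"
          by (simp add: A1_def power2_eq_square algebra_simps)
        finally show ?thesis
          using True by simp
      next
        case False
        have "f (R x v) \<le> K" "- f x \<le> K"
          using fK[OF x] fK[OF in_M[of 1]] by auto
        moreover have "- (v \<bullet> f' x) \<le> norm v * K"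
          using norm_cauchy_schwarz[of "- v" "f' x"] f'K[OF x] mult_left_mono[of "norm (f' x)" K "norm v"]
          by simp
        ultimately have upper: "f (R x v) - f x - v \<bullet> f' x \<le> K * (2 + norm v)"
          by (simp add: algebra_simps)
        have "2 + norm v \<le> A2 * (norm v)\<^sup>2"
        proof -
          have "1 \<le> norm v / \<delta>"
            using False \<delta> by simp
          then have "1 \<le> (norm v / \<delta>)\<^sup>2"
            by simp
          moreover have "norm v * 1 \<le> norm v * (norm v / \<delta>)"
            using \<open>1 \<le> norm v / \<delta>\<close> by (intro mult_left_mono) auto
          moreover have "A2 * (norm v)\<^sup>2 = 2 * (norm v / \<delta>)\<^sup>2 + norm v * (norm v / \<delta>)"
            by (simp add: A2_def algebra_simps power_divide power2_eq_square)
          ultimately show ?thesis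
            by linarith
        qed
        from order_trans[OF upper mult_left_mono[OF this K]] show ?thesis
          using False by (simp add: mult_ac)
      qed
      also have "(if norm v \<le> \<delta> then A1 else A2) * K * (norm v)\<^sup>2 \<le> (A1 + A2) * K * (norm v)\<^sup>2"
        using A1 A2 K by (intro mult_right_mono) auto
      finally show "f (R x v) \<le> f x + v \<bullet> f' x + (A1 + A2) * K * (norm v)\<^sup>2"
        by simp
    qed
  qed
qed

section \<open>Derivatives of the smoothed objective\<close>

text \<open>Concavity of \<open>t \<mapsto> t powr p\<close>, obtained from Young's inequality for \<open>a powr p * b powr (1 - p)\<close>.\<close>

lemma powr_le_tangent:
  fixes a b p :: real
  assumes "0 < p" "p \<le> 1" "0 < a" "0 < b"
  shows "a powr p \<le> b powr p + p * b powr (p - 1) * (a - b)"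
proof -
  have "a powr p * b powr (1 - p) \<le> p * a + (1 - p) * b"
    using assms by (intro Youngs_inequality_0) auto
  then have *: "a powr p * b powr (1 - p) * b powr (p - 1) \<le> (p * a + (1 - p) * b) * b powr (p - 1)"
    by (rule mult_right_mono) simp
  have "a powr p = a powr p * (b powr (1 - p) * b powr (p - 1))"
    using assms(4) by (simp flip: powr_add)
  also have "\<dots> \<le> (p * a + (1 - p) * b) * b powr (p - 1)"
    using * by (simp add: mult.assoc)
  also have "\<dots> = b * b powr (p - 1) + p * b powr (p - 1) * (a - b)"
    by (simp add: algebra_simps)
  also have "b * b powr (p - 1) = b powr p"
    using assms(4) by (simp add: powr_mult_base)
  finally show ?thesis .
qed

lemma powr_neg_lipschitz:
  fixes a b q s :: real
  assumes "q \<le> 0" "0 < s" "s \<le> a" "s \<le> b"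
  shows "\<bar>a powr q - b powr q\<bar> \<le> - q * s powr (q - 1) * \<bar>a - b\<bar>"
proof -
  have "norm (a powr q - b powr q) \<le> - q * s powr (q - 1) * norm (a - b)"
  proof (rule field_differentiable_bound[of "{s..}"])
    fix z assume z: "z \<in> {s..}"
    show "((\<lambda>x. x powr q) has_field_derivative q * z powr (q - 1)) (at z within {s..})"
      using has_real_derivative_powr[of z q] z assms(2) by (simp add: has_field_derivative_at_within)
    show "norm (q * z powr (q - 1)) \<le> - q * s powr (q - 1)"
    proof -
      have "z powr (q - 1) \<le> s powr (q - 1)"
        using z assms by (intro powr_mono2') auto
      then have "- q * z powr (q - 1) \<le> - q * s powr (q - 1)"
        using assms(1) by (intro mult_left_mono) auto
      then show ?thesis
        using assms(1) by (simp add: abs_mult)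
    qed
  qed (use assms in auto)
  then show ?thesis
    by simp
qed

text \<open>The derivative of \<open>t \<mapsto> \<phi>s \<mu> t powr p\<close>.\<close>

definition powr_smoothing_deriv :: "real \<Rightarrow> (real \<Rightarrow> real \<Rightarrow> real) \<Rightarrow> real \<Rightarrow> real \<Rightarrow> real" where
  "powr_smoothing_deriv p \<phi>s \<mu> t = p * \<phi>s \<mu> t powr (p - 1) * deriv (\<phi>s \<mu>) t"

lemma smoothing_function_constants:
  assumes "smoothing_function \<phi> \<phi>s"
  obtains \<sigma> \<kappa> Q L where "0 < \<sigma>" "0 < \<kappa>" "0 < Q" "0 < L"
    and "\<And>t \<mu>. 0 < \<mu> \<Longrightarrow> \<sigma> * \<mu> \<le> \<phi>s \<mu> t"
    and "\<And>t \<mu>\<^sub>1 \<mu>\<^sub>2. 0 < \<mu>\<^sub>1 \<Longrightarrow> 0 < \<mu>\<^sub>2 \<Longrightarrow> \<bar>\<phi>s \<mu>\<^sub>1 t - \<phi>s \<mu>\<^sub>2 t\<bar> \<le> \<kappa> * \<bar>\<mu>\<^sub>1 - \<mu>\<^sub>2\<bar>"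
    and "\<And>t \<mu>. 0 < \<mu> \<Longrightarrow> \<bar>deriv (\<phi>s \<mu>) t\<bar> \<le> Q"
    and "\<And>\<mu>. 0 < \<mu> \<Longrightarrow> (L / \<mu>)-lipschitz_on UNIV (deriv (\<phi>s \<mu>))"
proof -
  have "(\<exists>\<sigma>>0. \<forall>t. \<forall>\<mu>>0. \<sigma> * \<mu> \<le> \<phi>s \<mu> t) \<and>
    (\<exists>\<kappa>>0. \<forall>t. \<forall>\<mu>1>0. \<forall>\<mu>2>0. \<bar>\<phi>s \<mu>1 t - \<phi>s \<mu>2 t\<bar> \<le> \<kappa> * \<bar>\<mu>1 - \<mu>2\<bar>) \<and>
    (\<exists>Q>0. \<forall>t. \<forall>\<mu>>0. \<bar>deriv (\<phi>s \<mu>) t\<bar> \<le> Q) \<and>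
    (\<exists>L>0. \<forall>\<mu>>0. (L / \<mu>)-lipschitz_on UNIV (deriv (\<phi>s \<mu>)))"
    using assms unfolding smoothing_function_def by (elim conjE) (intro conjI; assumption)
  then show ?thesis
    using that by metis
qed

lemma smoothing_function_DERIV:
  assumes "smoothing_function \<phi> \<phi>s" and "0 < \<mu>"
  shows "(\<phi>s \<mu> has_real_derivative deriv (\<phi>s \<mu>) t) (at t)"
proof -
  have "\<phi>s \<mu> C1_differentiable_on UNIV"
    using assms unfolding smoothing_function_def by (elim conjE) simp
  then have "\<phi>s \<mu> differentiable (at t)"
    unfolding C1_differentiable_on_eq by simp
  then show ?thesis
    using DERIV_deriv_iff_real_differentiable by blast
qed

lemma smoothing_function_pos:
  assumes "smoothing_function \<phi> \<phi>s" and "0 < \<mu>"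
  shows "0 < \<phi>s \<mu> t"
proof -
  obtain \<sigma> where "0 < \<sigma>" "\<And>t \<mu>. 0 < \<mu> \<Longrightarrow> \<sigma> * \<mu> \<le> \<phi>s \<mu> t"
    using smoothing_function_constants[OF assms(1)] by metis
  then show ?thesis
    using assms(2) by (meson less_le_trans mult_pos_pos)
qed

lemma powr_smoothing_DERIV:
  assumes "smoothing_function \<phi> \<phi>s" and "0 < \<mu>"
  shows "((\<lambda>t. \<phi>s \<mu> t powr p) has_real_derivative powr_smoothing_deriv p \<phi>s \<mu> t) (at t)"
  using DERIV_chain2[OF has_real_derivative_powr[OF smoothing_function_pos[OF assms]]
      smoothing_function_DERIV[OF assms]]
  unfolding powr_smoothing_deriv_def .

text \<open>The lower bound \<open>\<sigma> * \<mu>\<close> on \<open>\<phi>s \<mu>\<close> turns the negative powers \<open>p - 1\<close> and \<open>p - 2\<close> of \<open>\<phi>s \<mu> t\<close> into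
  powers of \<open>\<mu>\<close>. The two sources of variation, the factor \<open>\<phi>s \<mu> t powr (p - 1)\<close> and the derivative of
  \<open>\<phi>s \<mu>\<close> with its Lipschitz constant \<open>L / \<mu>\<close>, contribute the same order \<open>\<mu> powr (p - 2)\<close>.\<close>

lemma powr_smoothing_deriv_bounds:
  assumes sm: "smoothing_function \<phi> \<phi>s" and p: "0 < p" "p \<le> 1"
  obtains C where "0 \<le> C"
    and "\<And>\<mu> t. 0 < \<mu> \<Longrightarrow> \<mu> \<le> 1 \<Longrightarrow> \<bar>powr_smoothing_deriv p \<phi>s \<mu> t\<bar> \<le> C * \<mu> powr (p - 2)"
    and "\<And>\<mu>. 0 < \<mu> \<Longrightarrow> \<mu> \<le> 1 \<Longrightarrow> (C * \<mu> powr (p - 2))-lipschitz_on UNIV (powr_smoothing_deriv p \<phi>s \<mu>)"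
proof -
  obtain \<sigma> Q L where \<sigma>: "0 < \<sigma>" "\<And>t \<mu>. 0 < \<mu> \<Longrightarrow> \<sigma> * \<mu> \<le> \<phi>s \<mu> t"
    and Q: "0 < Q" "\<And>t \<mu>. 0 < \<mu> \<Longrightarrow> \<bar>deriv (\<phi>s \<mu>) t\<bar> \<le> Q"
    and L: "0 < L" "\<And>\<mu>. 0 < \<mu> \<Longrightarrow> (L / \<mu>)-lipschitz_on UNIV (deriv (\<phi>s \<mu>))"
    using smoothing_function_constants[OF sm] by metis
  define C where "C = \<sigma> powr (p - 1) * Q + \<sigma> powr (p - 2) * Q\<^sup>2 + \<sigma> powr (p - 1) * L"
  have C: "\<sigma> powr (p - 1) * Q \<le> C" "\<sigma> powr (p - 2) * Q\<^sup>2 + \<sigma> powr (p - 1) * L \<le> C" "0 \<le> C"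
    unfolding C_def using Q(1) L(1) by auto
  have low: "\<phi>s \<mu> t powr (p - 1) \<le> \<sigma> powr (p - 1) * \<mu> powr (p - 1)" if "0 < \<mu>" for \<mu> t
    using powr_mono2'[of "p - 1" "\<sigma> * \<mu>" "\<phi>s \<mu> t"] \<sigma> that p by (simp add: powr_mult)
  show ?thesis
  proof (rule that[OF C(3)])
    fix \<mu> :: real assume \<mu>: "0 < \<mu>" "\<mu> \<le> 1"
    have pow: "\<mu> powr (p - 1) \<le> \<mu> powr (p - 2)"
      using \<mu> by (intro powr_mono') auto
    have bound: "\<bar>powr_smoothing_deriv p \<phi>s \<mu> t\<bar> \<le> C * \<mu> powr (p - 2)" for t
    proof -
      have "\<bar>powr_smoothing_deriv p \<phi>s \<mu> t\<bar> = p * \<phi>s \<mu> t powr (p - 1) * \<bar>deriv (\<phi>s \<mu>) t\<bar>"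
        using p by (simp add: powr_smoothing_deriv_def abs_mult)
      also have "\<dots> \<le> 1 * (\<sigma> powr (p - 1) * \<mu> powr (p - 1)) * Q"
        using p low[OF \<mu>(1)] Q \<mu> by (intro mult_mono) auto
      also have "\<dots> = \<sigma> powr (p - 1) * Q * \<mu> powr (p - 1)"
        by simp
      also have "\<dots> \<le> C * \<mu> powr (p - 2)"
        using C(1,3) pow by (intro mult_mono) auto
      finally show ?thesis .
    qed
    then show "\<bar>powr_smoothing_deriv p \<phi>s \<mu> t\<bar> \<le> C * \<mu> powr (p - 2)" for t .
    show "(C * \<mu> powr (p - 2))-lipschitz_on UNIV (powr_smoothing_deriv p \<phi>s \<mu>)"
    proof (rule lipschitz_onI)
      fix s t :: real
      let ?a = "\<phi>s \<mu> s" and ?b = "\<phi>s \<mu> t" and ?d = "deriv (\<phi>s \<mu>) s" and ?e = "deriv (\<phi>s \<mu>) t"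
      let ?w = "\<mu> powr (p - 2)"
      have ab: "\<bar>?a - ?b\<bar> \<le> Q * \<bar>s - t\<bar>"
        using field_differentiable_bound[of UNIV "\<phi>s \<mu>" "deriv (\<phi>s \<mu>)" Q s t]
          smoothing_function_DERIV[OF sm \<mu>(1)] Q(2)[OF \<mu>(1)] by simp
      have "\<bar>?a powr (p - 1) - ?b powr (p - 1)\<bar>
          \<le> - (p - 1) * (\<sigma> * \<mu>) powr (p - 1 - 1) * \<bar>?a - ?b\<bar>"
        using p \<sigma> \<mu> by (intro powr_neg_lipschitz) auto
      also have "\<dots> \<le> 1 * (\<sigma> * \<mu>) powr (p - 1 - 1) * (Q * \<bar>s - t\<bar>)"
        using p ab by (intro mult_mono) auto
      finally have 1: "\<bar>?a powr (p - 1) - ?b powr (p - 1)\<bar> \<le> \<sigma> powr (p - 2) * ?w * (Q * \<bar>s - t\<bar>)"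
        using \<sigma>(1) \<mu> by (simp add: powr_mult)
      have 2: "\<bar>?d - ?e\<bar> \<le> L / \<mu> * \<bar>s - t\<bar>"
        using lipschitz_onD[OF L(2)[OF \<mu>(1)], of s t] by (simp add: dist_real_def)
      have \<mu>': "\<mu> powr (p - 1) / \<mu> = ?w"
        using \<mu> powr_mult_base[of \<mu> "p - 2"] by (simp add: field_simps)
      have "powr_smoothing_deriv p \<phi>s \<mu> s - powr_smoothing_deriv p \<phi>s \<mu> t
          = p * ((?a powr (p - 1) - ?b powr (p - 1)) * ?d + ?b powr (p - 1) * (?d - ?e))"
        by (simp add: powr_smoothing_deriv_def algebra_simps)
      then have "\<bar>powr_smoothing_deriv p \<phi>s \<mu> s - powr_smoothing_deriv p \<phi>s \<mu> t\<bar>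
          = p * \<bar>(?a powr (p - 1) - ?b powr (p - 1)) * ?d + ?b powr (p - 1) * (?d - ?e)\<bar>"
        using p by (simp add: abs_mult)
      also have "\<dots> \<le> 1 * (\<bar>?a powr (p - 1) - ?b powr (p - 1)\<bar> * \<bar>?d\<bar> + ?b powr (p - 1) * \<bar>?d - ?e\<bar>)"
        using p by (intro mult_mono) (auto simp: abs_mult intro: order_trans[OF abs_triangle_ineq])
      also have "\<dots> \<le> 1 * ((\<sigma> powr (p - 2) * ?w * (Q * \<bar>s - t\<bar>)) * Q
          + (\<sigma> powr (p - 1) * \<mu> powr (p - 1)) * (L / \<mu> * \<bar>s - t\<bar>))"
        using 1 2 Q low[OF \<mu>(1)] \<mu> by (intro mult_left_mono add_mono mult_mono) auto
      also have "\<dots> = (\<sigma> powr (p - 2) * Q\<^sup>2 + \<sigma> powr (p - 1) * L) * (?w * \<bar>s - t\<bar>)"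
        unfolding \<mu>'[symmetric] by (simp add: algebra_simps power2_eq_square)
      also have "\<dots> \<le> C * (?w * \<bar>s - t\<bar>)"
        using C by (intro mult_right_mono) auto
      finally show "dist (powr_smoothing_deriv p \<phi>s \<mu> s) (powr_smoothing_deriv p \<phi>s \<mu> t)
          \<le> C * ?w * dist s t"
        by (simp add: dist_real_def mult_ac)
    qed (use C in auto)
  qed
qed

text \<open>The gradient is bounded on the convex hull of \<open>M\<close>, which is still compact and contains the chords
  needed for the mean value inequality.\<close>

lemma C1_lipschitz_on_compact:
  fixes f :: "'a::euclidean_space \<Rightarrow> real"
  assumes "compact M" and f: "\<And>x. f differentiable (at x)" and "continuous_on UNIV (gradient f)"
  obtains H where "H-lipschitz_on M f" and "\<And>x. x \<in> M \<Longrightarrow> norm (gradient f x) \<le> H"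
proof -
  let ?S = "convex hull M"
  have "compact (gradient f ` ?S)"
    using assms by (intro compact_continuous_image compact_convex_hull) (auto intro: continuous_on_subset)
  then have "bounded (gradient f ` ?S)"
    by (rule compact_imp_bounded)
  then obtain H where H: "0 < H" "\<And>x. x \<in> ?S \<Longrightarrow> norm (gradient f x) \<le> H"
    unfolding bounded_pos by auto
  have "H-lipschitz_on ?S f"
  proof (rule bounded_derivative_imp_lipschitz)
    fix x assume x: "x \<in> ?S"
    show "(f has_derivative (\<lambda>h. h \<bullet> gradient f x)) (at x within ?S)"
      using differentiable_GDERIV_gradient[OF f] unfolding gderiv_def by (rule has_derivative_at_withinI)
    have "onorm (\<lambda>h. h \<bullet> gradient f x) \<le> norm (gradient f x)"
      by (rule onorm_le) (simp add: Cauchy_Schwarz_ineq2 mult.commute)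
    then show "onorm (\<lambda>h. h \<bullet> gradient f x) \<le> H"
      using H(2)[OF x] by simp
  qed (use H in auto)
  then show ?thesis
    by (intro that[of H]) (use H(2) hull_subset[of M convex] lipschitz_on_subset in auto)
qed

lemma smoothed_objective_GDERIV:
  fixes g :: "'a::euclidean_space \<Rightarrow> real"
  assumes "smoothing_function \<phi> \<phi>s" and "0 < \<mu>"
    and "g differentiable (at x)" and "\<And>i. i \<in> {1..m} \<Longrightarrow> h i differentiable (at x)"
  shows "GDERIV (smoothed_objective g h m p \<phi>s \<mu>) x :>
    (gradient g x + (\<Sum>i=1..m. powr_smoothing_deriv p \<phi>s \<mu> (h i x) *\<^sub>R gradient (h i) x))"
proof -
  have "((\<lambda>X. g X + (\<Sum>i=1..m. \<phi>s \<mu> (h i X) powr p)) has_derivative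
      (\<lambda>v. v \<bullet> gradient g x
        + (\<Sum>i=1..m. v \<bullet> (powr_smoothing_deriv p \<phi>s \<mu> (h i x) *\<^sub>R gradient (h i) x)))) (at x)"
    using differentiable_GDERIV_gradient[OF assms(3)]
      GDERIV_DERIV_compose[OF differentiable_GDERIV_gradient[OF assms(4)] powr_smoothing_DERIV[OF assms(1,2)]]
    unfolding gderiv_def by (intro has_derivative_add has_derivative_sum) auto
  then show ?thesis
    unfolding gderiv_def smoothed_objective_def objective_def inner_add_right inner_sum_right .
qed

lemma powr_smoothing_composition_gradient_bounds:
  fixes h :: "'a::euclidean_space \<Rightarrow> real"
  assumes sm: "smoothing_function \<phi> \<phi>s" and p: "0 < p" "p \<le> 1" and M: "compact M"
    and "\<And>x. h differentiable (at x)" and "continuous_on UNIV (gradient h)"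
    and lip: "L-lipschitz_on M (gradient h)"
  obtains K where "0 \<le> K"
    and "\<And>\<mu> x. 0 < \<mu> \<Longrightarrow> \<mu> \<le> 1 \<Longrightarrow> x \<in> M \<Longrightarrow>
      norm (powr_smoothing_deriv p \<phi>s \<mu> (h x) *\<^sub>R gradient h x) \<le> K * \<mu> powr (p - 2)"
    and "\<And>\<mu>. 0 < \<mu> \<Longrightarrow> \<mu> \<le> 1 \<Longrightarrow>
      (K * \<mu> powr (p - 2))-lipschitz_on M (\<lambda>x. powr_smoothing_deriv p \<phi>s \<mu> (h x) *\<^sub>R gradient h x)"
proof -
  obtain C where C: "0 \<le> C"
    "\<And>\<mu> t. 0 < \<mu> \<Longrightarrow> \<mu> \<le> 1 \<Longrightarrow> \<bar>powr_smoothing_deriv p \<phi>s \<mu> t\<bar> \<le> C * \<mu> powr (p - 2)"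
    "\<And>\<mu>. 0 < \<mu> \<Longrightarrow> \<mu> \<le> 1 \<Longrightarrow> (C * \<mu> powr (p - 2))-lipschitz_on UNIV (powr_smoothing_deriv p \<phi>s \<mu>)"
    using powr_smoothing_deriv_bounds[OF sm p] by metis
  obtain H where H: "H-lipschitz_on M h" "\<And>x. x \<in> M \<Longrightarrow> norm (gradient h x) \<le> H"
    using C1_lipschitz_on_compact[OF M assms(5,6)] by metis
  have H0: "0 \<le> H" and L0: "0 \<le> L"
    using H(1) lip lipschitz_on_nonneg by blast+
  show ?thesis
  proof (rule that[of "C * (H\<^sup>2 + L + H)"])
    show "0 \<le> C * (H\<^sup>2 + L + H)"
      using C(1) H0 L0 by simp
    fix \<mu> :: real assume \<mu>: "0 < \<mu>" "\<mu> \<le> 1"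
    let ?d = "powr_smoothing_deriv p \<phi>s \<mu>" and ?w = "\<mu> powr (p - 2)"
    have w: "0 \<le> C * ?w" using C(1) by simp
    show "norm (?d (h x) *\<^sub>R gradient h x) \<le> C * (H\<^sup>2 + L + H) * ?w" if x: "x \<in> M" for x
    proof -
      have "norm (?d (h x) *\<^sub>R gradient h x) \<le> (C * ?w) * H"
        using C(2)[OF \<mu>] H(2)[OF x] w by (simp add: mult_mono)
      also have "\<dots> \<le> (C * ?w) * (H\<^sup>2 + L + H)"
        using w L0 by (intro mult_left_mono) auto
      finally show ?thesis by (simp add: mult_ac)
    qed
    show "(C * (H\<^sup>2 + L + H) * ?w)-lipschitz_on M (\<lambda>x. ?d (h x) *\<^sub>R gradient h x)"
    proof (rule lipschitz_onI)
      fix x y assume xy: "x \<in> M" "y \<in> M"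
      have "\<bar>?d (h x) - ?d (h y)\<bar> \<le> C * ?w * \<bar>h x - h y\<bar>"
        using lipschitz_onD[OF C(3)[OF \<mu>]] by (simp add: dist_real_def)
      also have "\<dots> \<le> C * ?w * (H * dist x y)"
        using lipschitz_onD[OF H(1) xy] w by (intro mult_left_mono) (simp_all add: dist_real_def)
      finally have d: "\<bar>?d (h x) - ?d (h y)\<bar> \<le> C * ?w * (H * dist x y)" .
      have "dist (?d (h x) *\<^sub>R gradient h x) (?d (h y) *\<^sub>R gradient h y)
          = norm ((?d (h x) - ?d (h y)) *\<^sub>R gradient h x + ?d (h y) *\<^sub>R (gradient h x - gradient h y))"
        by (simp add: dist_norm algebra_simps)
      also have "\<dots> \<le> \<bar>?d (h x) - ?d (h y)\<bar> * norm (gradient h x)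
          + \<bar>?d (h y)\<bar> * norm (gradient h x - gradient h y)"
        by (rule order_trans[OF norm_triangle_ineq]) simp
      also have "\<dots> \<le> (C * ?w * (H * dist x y)) * H + (C * ?w) * (L * dist x y)"
        using d H(2)[OF xy(1)] H0 w C(2)[OF \<mu>] lipschitz_onD[OF lip xy]
        by (intro add_mono mult_mono) (auto simp: dist_norm)
      also have "\<dots> = (C * ?w) * (H\<^sup>2 + L) * dist x y"
        by (simp add: algebra_simps power2_eq_square)
      also have "\<dots> \<le> (C * ?w) * (H\<^sup>2 + L + H) * dist x y"
        using w H0 by (intro mult_right_mono mult_left_mono) auto
      finally show "dist (?d (h x) *\<^sub>R gradient h x) (?d (h y) *\<^sub>R gradient h y)
          \<le> C * (H\<^sup>2 + L + H) * ?w * dist x y"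
        by (simp add: mult_ac)
    qed (use w H0 L0 C(1) in simp)
  qed
qed

text \<open>One constant \<open>K\<close> for all \<open>\<mu> \<le> 1\<close>. The values stay bounded without any power of \<open>\<mu>\<close> because \<open>\<phi>s \<mu>\<close>
  differs from \<open>\<phi>s 1\<close> by at most \<open>\<kappa>\<close>; this later bounds the potential of the algorithm.\<close>

lemma smoothed_objective_bounds:
  fixes g :: "'a::euclidean_space \<Rightarrow> real"
  assumes sm: "smoothing_function \<phi> \<phi>s" and p: "0 < p" "p \<le> 1" and M: "compact M"
    and g: "\<And>x. g differentiable (at x)" "continuous_on UNIV (gradient g)"
    and h: "\<And>i x. i \<in> {1..m} \<Longrightarrow> h i differentiable (at x)"
      "\<And>i. i \<in> {1..m} \<Longrightarrow> continuous_on UNIV (gradient (h i))"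
    and lip: "L\<^sub>g-lipschitz_on M (gradient g)"
      "\<And>i. i \<in> {1..m} \<Longrightarrow> L\<^sub>h-lipschitz_on M (gradient (h i))"
  obtains K where "0 < K"
    and "\<And>\<mu> x. 0 < \<mu> \<Longrightarrow> \<mu> \<le> 1 \<Longrightarrow> x \<in> M \<Longrightarrow> \<bar>smoothed_objective g h m p \<phi>s \<mu> x\<bar> \<le> K"
    and "\<And>\<mu> x. 0 < \<mu> \<Longrightarrow> \<mu> \<le> 1 \<Longrightarrow> x \<in> M \<Longrightarrow>
      norm (gradient (smoothed_objective g h m p \<phi>s \<mu>) x) \<le> K * \<mu> powr (p - 2)"
    and "\<And>\<mu>. 0 < \<mu> \<Longrightarrow> \<mu> \<le> 1 \<Longrightarrow>
      (K * \<mu> powr (p - 2))-lipschitz_on M (gradient (smoothed_objective g h m p \<phi>s \<mu>))"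
proof -
  let ?T = "\<lambda>i \<mu> x. powr_smoothing_deriv p \<phi>s \<mu> (h i x) *\<^sub>R gradient (h i) x"
  have grad: "gradient (smoothed_objective g h m p \<phi>s \<mu>) = (\<lambda>x. gradient g x + (\<Sum>i=1..m. ?T i \<mu> x))"
    if "0 < \<mu>" for \<mu>
    by (intro ext gradient_eq smoothed_objective_GDERIV[OF sm that g(1)] h(1))
  obtain H where H: "H-lipschitz_on M g" "\<And>x. x \<in> M \<Longrightarrow> norm (gradient g x) \<le> H"
    using C1_lipschitz_on_compact[OF M g] by metis
  have H0: "0 \<le> H" and L0: "0 \<le> L\<^sub>g"
    using H(1) lip(1) lipschitz_on_nonneg by blast+
  define good where "good i K \<longleftrightarrow> 0 \<le> K \<and> (\<forall>\<mu>. 0 < \<mu> \<and> \<mu> \<le> 1 \<longrightarrow>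
      (\<forall>x\<in>M. norm (?T i \<mu> x) \<le> K * \<mu> powr (p - 2)) \<and>
      (K * \<mu> powr (p - 2))-lipschitz_on M (?T i \<mu>))" for i K
  have "\<exists>K. good i K" if "i \<in> {1..m}" for i
  proof (rule powr_smoothing_composition_gradient_bounds[OF sm p M h(1)[OF that] h(2)[OF that] lip(2)[OF that]])
    fix K assume "0 \<le> K"
      and "\<And>\<mu> x. 0 < \<mu> \<Longrightarrow> \<mu> \<le> 1 \<Longrightarrow> x \<in> M \<Longrightarrow> norm (?T i \<mu> x) \<le> K * \<mu> powr (p - 2)"
      and "\<And>\<mu>. 0 < \<mu> \<Longrightarrow> \<mu> \<le> 1 \<Longrightarrow> (K * \<mu> powr (p - 2))-lipschitz_on M (?T i \<mu>)"
    then show ?thesis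
      unfolding good_def by (intro exI[of _ K]) simp
  qed
  then obtain k where "\<And>i. i \<in> {1..m} \<Longrightarrow> good i (k i)"
    by metis
  then have k: "\<And>i. i \<in> {1..m} \<Longrightarrow> 0 \<le> k i"
    "\<And>i \<mu> x. i \<in> {1..m} \<Longrightarrow> 0 < \<mu> \<Longrightarrow> \<mu> \<le> 1 \<Longrightarrow> x \<in> M \<Longrightarrow> norm (?T i \<mu> x) \<le> k i * \<mu> powr (p - 2)"
    "\<And>i \<mu>. i \<in> {1..m} \<Longrightarrow> 0 < \<mu> \<Longrightarrow> \<mu> \<le> 1 \<Longrightarrow> (k i * \<mu> powr (p - 2))-lipschitz_on M (?T i \<mu>)"
    unfolding good_def by simp_all
  obtain \<kappa> where \<kappa>: "0 < \<kappa>"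
    "\<And>t \<mu>\<^sub>1 \<mu>\<^sub>2. 0 < \<mu>\<^sub>1 \<Longrightarrow> 0 < \<mu>\<^sub>2 \<Longrightarrow> \<bar>\<phi>s \<mu>\<^sub>1 t - \<phi>s \<mu>\<^sub>2 t\<bar> \<le> \<kappa> * \<bar>\<mu>\<^sub>1 - \<mu>\<^sub>2\<bar>"
    using smoothing_function_constants[OF sm] by metis
  have cont: "continuous_on M u" if "\<And>x. u differentiable (at x)" for u :: "'a \<Rightarrow> real"
    using that by (meson continuous_at_imp_continuous_on differentiable_imp_continuous_within)
  have bdd: "\<exists>B. \<forall>x\<in>M. \<bar>u x\<bar> \<le> B" if "continuous_on M u" for u :: "'a \<Rightarrow> real"
  proof -
    have "bounded (u ` M)"
      using M that by (intro compact_imp_bounded compact_continuous_image)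
    then show ?thesis
      unfolding bounded_iff by auto
  qed
  obtain G where G: "\<And>x. x \<in> M \<Longrightarrow> \<bar>g x\<bar> \<le> G"
    using bdd[OF cont[OF g(1)]] by blast
  have "\<exists>B. \<forall>x\<in>M. \<bar>\<phi>s 1 (h i x)\<bar> \<le> B" if "i \<in> {1..m}" for i
  proof (rule bdd)
    have "continuous_on UNIV (\<phi>s 1)"
      using smoothing_function_DERIV[OF sm zero_less_one]
      by (meson DERIV_isCont continuous_at_imp_continuous_on)
    then show "continuous_on M (\<lambda>x. \<phi>s 1 (h i x))"
      by (rule continuous_on_compose2) (use cont h(1) that in auto)
  qed
  then obtain B where B: "\<And>i x. i \<in> {1..m} \<Longrightarrow> x \<in> M \<Longrightarrow> \<bar>\<phi>s 1 (h i x)\<bar> \<le> B i"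
    by metis
  define K where "K = 1 + \<bar>G\<bar> + (\<Sum>i=1..m. (B i + \<kappa>) powr p) + H + L\<^sub>g + (\<Sum>i=1..m. k i)"
  have sum0: "0 \<le> (\<Sum>i=1..m. k i)" "0 \<le> (\<Sum>i=1..m. (B i + \<kappa>) powr p)"
    using k(1) by (auto intro!: sum_nonneg)
  show ?thesis
  proof (rule that[of K])
    show K0: "0 < K"
      unfolding K_def using sum0 H0 L0 by linarith
    fix \<mu> :: real assume \<mu>: "0 < \<mu>" "\<mu> \<le> 1"
    have w: "1 \<le> \<mu> powr (p - 2)"
      using powr_mono2'[of "p - 2" \<mu> 1] \<mu> p by simp
    show "\<bar>smoothed_objective g h m p \<phi>s \<mu> x\<bar> \<le> K" if x: "x \<in> M" for x
    proof -
      have "\<phi>s \<mu> (h i x) powr p \<le> (B i + \<kappa>) powr p" if i: "i \<in> {1..m}" for i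
      proof (rule powr_mono2)
        have "\<phi>s \<mu> (h i x) \<le> \<phi>s 1 (h i x) + \<kappa> * \<bar>1 - \<mu>\<bar>"
          using \<kappa>(2)[of 1 \<mu> "h i x"] \<mu> by linarith
        also have "\<kappa> * \<bar>1 - \<mu>\<bar> \<le> \<kappa>"
          using \<kappa>(1) \<mu> by (intro mult_left_le) auto
        finally show "\<phi>s \<mu> (h i x) \<le> B i + \<kappa>"
          using B[OF i x] by linarith
      qed (use p smoothing_function_pos[OF sm \<mu>(1)] in \<open>auto intro: less_imp_le\<close>)
      then have "(\<Sum>i=1..m. \<phi>s \<mu> (h i x) powr p) \<le> (\<Sum>i=1..m. (B i + \<kappa>) powr p)"
        by (rule sum_mono)
      moreover have "0 \<le> (\<Sum>i=1..m. \<phi>s \<mu> (h i x) powr p)"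
        by (intro sum_nonneg) simp
      ultimately show ?thesis
        unfolding smoothed_objective_def objective_def K_def using G[OF x] sum0 H0 L0 by linarith
    qed
    show "norm (gradient (smoothed_objective g h m p \<phi>s \<mu>) x) \<le> K * \<mu> powr (p - 2)" if x: "x \<in> M" for x
    proof -
      have "norm (gradient g x + (\<Sum>i=1..m. ?T i \<mu> x)) \<le> H + (\<Sum>i=1..m. k i * \<mu> powr (p - 2))"
        by (rule order_trans[OF norm_triangle_ineq add_mono[OF H(2)[OF x] sum_norm_le]])
          (use k(2) \<mu> x in auto)
      also have "\<dots> \<le> H * \<mu> powr (p - 2) + (\<Sum>i=1..m. k i) * \<mu> powr (p - 2)"
        using mult_left_mono[OF w H0] by (simp add: sum_distrib_right)
      also have "\<dots> \<le> K * \<mu> powr (p - 2)"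
        unfolding distrib_right[symmetric] by (rule mult_right_mono) (use sum0 L0 in \<open>auto simp: K_def\<close>)
      finally show ?thesis
        unfolding grad[OF \<mu>(1)] .
    qed
    show "(K * \<mu> powr (p - 2))-lipschitz_on M (gradient (smoothed_objective g h m p \<phi>s \<mu>))"
    proof (rule lipschitz_onI)
      fix x y assume xy: "x \<in> M" "y \<in> M"
      have "dist (gradient g x + (\<Sum>i=1..m. ?T i \<mu> x)) (gradient g y + (\<Sum>i=1..m. ?T i \<mu> y))
          = norm ((gradient g x - gradient g y) + (\<Sum>i=1..m. ?T i \<mu> x - ?T i \<mu> y))"
        by (simp add: dist_norm sum_subtractf algebra_simps)
      also have "\<dots> \<le> L\<^sub>g * dist x y + (\<Sum>i=1..m. k i * \<mu> powr (p - 2) * dist x y)"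
        by (rule order_trans[OF norm_triangle_ineq add_mono[OF _ sum_norm_le]])
          (use lipschitz_onD[OF lip(1) xy] lipschitz_onD[OF k(3)[OF _ \<mu>] xy] in \<open>auto simp: dist_norm\<close>)
      also have "\<dots> \<le> (L\<^sub>g * \<mu> powr (p - 2) + (\<Sum>i=1..m. k i) * \<mu> powr (p - 2)) * dist x y"
        using mult_right_mono[OF mult_left_mono[OF w L0], of "dist x y"]
        by (simp add: sum_distrib_right distrib_right)
      also have "\<dots> \<le> K * \<mu> powr (p - 2) * dist x y"
        unfolding distrib_right[symmetric]
        by (intro mult_right_mono) (use sum0 H0 in \<open>auto simp: K_def\<close>)
      finally show "dist (gradient (smoothed_objective g h m p \<phi>s \<mu>) x)
          (gradient (smoothed_objective g h m p \<phi>s \<mu>) y) \<le> K * \<mu> powr (p - 2) * dist x y"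
        unfolding grad[OF \<mu>(1)] .
    qed (use K0 in simp)
  qed
qed

text \<open>The crude bound \<open>(\<kappa> * (\<mu>\<^sub>1 - \<mu>\<^sub>2)) powr p\<close> per summand would not be summable along the algorithm for
  small \<open>p\<close>. The tangent of \<open>t \<mapsto> t powr p\<close> at the value for the larger parameter \<open>\<mu>\<^sub>1\<close>, which is at
  least \<open>\<sigma> * \<mu>\<^sub>1\<close>, gives a multiple of \<open>\<mu>\<^sub>1 powr (p - 1) * (\<mu>\<^sub>1 - \<mu>\<^sub>2)\<close> instead, and concavity bounds
  this by a difference that telescopes.\<close>

lemma smoothed_objective_parameter_drift:
  assumes sm: "smoothing_function \<phi> \<phi>s" and p: "0 < p" "p \<le> 1"
  obtains C where "0 \<le> C"
    and "\<And>\<mu>\<^sub>1 \<mu>\<^sub>2 x. 0 < \<mu>\<^sub>2 \<Longrightarrow> \<mu>\<^sub>2 \<le> \<mu>\<^sub>1 \<Longrightarrow>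
      smoothed_objective g h m p \<phi>s \<mu>\<^sub>2 x
        \<le> smoothed_objective g h m p \<phi>s \<mu>\<^sub>1 x + C * (\<mu>\<^sub>1 powr p - \<mu>\<^sub>2 powr p)"
proof -
  obtain \<sigma> \<kappa> where \<sigma>: "0 < \<sigma>" "\<And>t \<mu>. 0 < \<mu> \<Longrightarrow> \<sigma> * \<mu> \<le> \<phi>s \<mu> t"
    and \<kappa>: "0 < \<kappa>" "\<And>t \<mu>\<^sub>1 \<mu>\<^sub>2. 0 < \<mu>\<^sub>1 \<Longrightarrow> 0 < \<mu>\<^sub>2 \<Longrightarrow> \<bar>\<phi>s \<mu>\<^sub>1 t - \<phi>s \<mu>\<^sub>2 t\<bar> \<le> \<kappa> * \<bar>\<mu>\<^sub>1 - \<mu>\<^sub>2\<bar>"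
    using smoothing_function_constants[OF sm] by metis
  define c where "c = \<sigma> powr (p - 1) * \<kappa>"
  have c: "0 \<le> c" unfolding c_def using \<kappa> by simp
  have summand: "\<phi>s \<mu>\<^sub>2 t powr p \<le> \<phi>s \<mu>\<^sub>1 t powr p + c * (\<mu>\<^sub>1 powr p - \<mu>\<^sub>2 powr p)"
    if \<mu>: "0 < \<mu>\<^sub>2" "\<mu>\<^sub>2 \<le> \<mu>\<^sub>1" for \<mu>\<^sub>1 \<mu>\<^sub>2 t
  proof -
    have \<mu>1: "0 < \<mu>\<^sub>1" using \<mu> by simp
    let ?a = "\<phi>s \<mu>\<^sub>2 t" and ?b = "\<phi>s \<mu>\<^sub>1 t"
    have "?a powr p - ?b powr p \<le> p * ?b powr (p - 1) * (?a - ?b)"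
      using powr_le_tangent[OF p smoothing_function_pos[OF sm \<mu>(1), of t] smoothing_function_pos[OF sm \<mu>1, of t]]
      by simp
    also have "\<dots> \<le> p * ?b powr (p - 1) * (\<kappa> * (\<mu>\<^sub>1 - \<mu>\<^sub>2))"
      using \<kappa>(2)[OF \<mu>(1) \<mu>1, of t] \<mu> p by (intro mult_left_mono) auto
    also have "\<dots> \<le> p * (\<sigma> * \<mu>\<^sub>1) powr (p - 1) * (\<kappa> * (\<mu>\<^sub>1 - \<mu>\<^sub>2))"
      using p \<sigma> \<mu> \<mu>1 \<kappa>(1) by (intro mult_right_mono mult_left_mono powr_mono2') auto
    also have "\<dots> = c * (p * \<mu>\<^sub>1 powr (p - 1) * (\<mu>\<^sub>1 - \<mu>\<^sub>2))"
      using \<sigma>(1) \<mu>1 by (simp add: c_def powr_mult)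
    also have "\<dots> \<le> c * (\<mu>\<^sub>1 powr p - \<mu>\<^sub>2 powr p)"
      using powr_le_tangent[OF p \<mu>(1) \<mu>1] c by (intro mult_left_mono) (auto simp: algebra_simps)
    finally show ?thesis by simp
  qed
  show ?thesis
  proof (rule that[of "real m * c"])
    show "0 \<le> real m * c" using c by simp
    fix \<mu>\<^sub>1 \<mu>\<^sub>2 :: real and x assume \<mu>: "0 < \<mu>\<^sub>2" "\<mu>\<^sub>2 \<le> \<mu>\<^sub>1"
    have "(\<Sum>i=1..m. \<phi>s \<mu>\<^sub>2 (h i x) powr p)
        \<le> (\<Sum>i=1..m. \<phi>s \<mu>\<^sub>1 (h i x) powr p + c * (\<mu>\<^sub>1 powr p - \<mu>\<^sub>2 powr p))"
      by (intro sum_mono summand \<mu>)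
    then show "smoothed_objective g h m p \<phi>s \<mu>\<^sub>2 x
        \<le> smoothed_objective g h m p \<phi>s \<mu>\<^sub>1 x + real m * c * (\<mu>\<^sub>1 powr p - \<mu>\<^sub>2 powr p)"
      by (simp add: smoothed_objective_def objective_def sum.distrib mult.assoc)
  qed
qed

section \<open>Growth of the normalization and decay of the gradient\<close>

text \<open>As \<open>a (Suc k)\<close> is the increment of \<open>\<eta>\<^sup>2\<close>, the quotient \<open>a (Suc k) / \<eta> (Suc k)\<close> is at least the
  increment of \<open>\<eta>\<close>. While \<open>\<eta>\<close> exceeds \<open>2 * \<Lambda>\<close>, the error term eats up at most half of the decrease,
  so every increase of \<open>\<eta>\<close> is paid for by half as large a decrease of the bounded quantity \<open>F\<close>.\<close>

lemma adaptive_normalization_bounded: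
  fixes \<eta> a F :: "nat \<Rightarrow> real"
  assumes \<eta>: "\<And>k. 0 < \<eta> k" "\<And>k. (\<eta> (Suc k))\<^sup>2 = (\<eta> k)\<^sup>2 + a (Suc k)"
    and a: "\<And>k. 0 \<le> a (Suc k)"
    and F: "\<And>k. F (Suc (Suc k)) \<le> F (Suc k) - a (Suc k) / \<eta> (Suc k) + \<Lambda> * (a (Suc k) / (\<eta> (Suc k))\<^sup>2)"
    and bound: "\<And>k. \<bar>F (Suc k)\<bar> \<le> S"
  shows "\<eta> k \<le> max (\<eta> 0) (2 * \<Lambda>) + 4 * S"
proof -
  define B where "B = max (\<eta> 0) (2 * \<Lambda>)"
  have B: "\<eta> 0 \<le> B" "2 * \<Lambda> \<le> B"
    by (auto simp: B_def)
  have "\<eta> k \<le> B + 2 * S - 2 * F (Suc k)" for k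
  proof (induction k)
    case 0
    then show ?case
      using abs_le_D1[OF bound[of 0]] B(1) by linarith
  next
    case (Suc k)
    show ?case
    proof (cases "\<eta> (Suc k) \<le> B")
      case True
      then show ?thesis
        using abs_le_D1[OF bound[of "Suc k"]] by linarith
    next
      case False
      let ?e = "\<eta> k" and ?e' = "\<eta> (Suc k)"
      have pos: "0 < ?e" "0 < ?e'" by (rule \<eta>(1))+
      have a_eq: "a (Suc k) = (?e' - ?e) * (?e' + ?e)"
        using \<eta>(2)[of k] by (simp add: power2_eq_square algebra_simps)
      have le: "?e \<le> ?e'"
        by (rule power2_le_imp_le) (use \<eta>(2)[of k] a[of k] pos in auto)
      define q r where "q = a (Suc k) / ?e'" and "r = \<Lambda> * (a (Suc k) / ?e'\<^sup>2)"
      have "?e' - ?e \<le> q"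
        unfolding q_def a_eq using pos le by (simp add: pos_le_divide_eq mult_left_mono)
      moreover have "2 * r \<le> q"
      proof -
        have "(2 * \<Lambda>) * (a (Suc k) / ?e'\<^sup>2) \<le> ?e' * (a (Suc k) / ?e'\<^sup>2)"
          using False B a[of k] by (intro mult_right_mono) auto
        also have "\<dots> = q"
          using pos by (simp add: q_def power2_eq_square)
        finally show ?thesis by (simp add: r_def)
      qed
      moreover have "F (Suc (Suc k)) \<le> F (Suc k) - q + r"
        using F[of k] by (simp add: q_def r_def)
      ultimately show ?thesis
        using Suc.IH by linarith
    qed
  qed
  from this[of k] abs_le_D2[OF bound[of k]] have "\<eta> k \<le> B + 4 * S"
    by linarith
  then show ?thesis
    by (simp add: B_def)
qed

lemma ASRGA_run_in_manifold:
  assumes sub: "\<And>x. x \<in> M \<Longrightarrow> subspace (tangent_space M x)"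
    and R: "manifold_retraction M R" and run: "ASRGA_run M R p fs \<mu> \<eta> X"
  shows "X k \<in> M"
proof (induction k)
  case 0
  then show ?case
    using run by (simp add: ASRGA_run_def)
next
  case (Suc k)
  show ?case
  proof (cases "k = 0")
    case True
    then show ?thesis
      using run Suc.IH by (simp add: ASRGA_run_def)
  next
    case False
    then have "X (Suc k) = R (X k) (- ((\<mu> k powr (2 - p) / \<eta> k) *\<^sub>R riem_grad M (fs (\<mu> k)) (X k)))"
      using run unfolding ASRGA_run_def by (metis One_nat_def Suc_eq_plus1 Suc_leI neq0_conv)
    moreover have "- ((\<mu> k powr (2 - p) / \<eta> k) *\<^sub>R riem_grad M (fs (\<mu> k)) (X k)) \<in> tangent_space M (X k)"
      using sub[OF Suc.IH] by (simp add: riem_grad_tangent(1) subspace_neg subspace_scale)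
    ultimately show ?thesis
      using R Suc.IH unfolding manifold_retraction_def tangent_bundle_def by auto
  qed
qed

lemma ASRGA_run_step:
  assumes "ASRGA_run M R p fs \<mu> \<eta> X"
  shows "\<mu> (Suc k) = real (Suc k) powr (- 1 / (4 - p))" and "0 < \<eta> k"
    and "(\<eta> (Suc k))\<^sup>2 = (\<eta> k)\<^sup>2
      + \<mu> (Suc k) powr (2 - p) * (norm (riem_grad M (fs (\<mu> (Suc k))) (X (Suc k))))\<^sup>2"
    and "X (Suc (Suc k)) = R (X (Suc k))
      (- ((\<mu> (Suc k) powr (2 - p) / \<eta> (Suc k)) *\<^sub>R riem_grad M (fs (\<mu> (Suc k))) (X (Suc k))))"
proof -
  have step: "\<forall>k\<ge>1. \<mu> k = real k powr (- 1 / (4 - p)) \<and> 0 < \<eta> k \<and>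
      (\<eta> k)\<^sup>2 = (\<eta> (k - 1))\<^sup>2 + \<mu> k powr (2 - p) * (norm (riem_grad M (fs (\<mu> k)) (X k)))\<^sup>2 \<and>
      X (k + 1) = R (X k) (- ((\<mu> k powr (2 - p) / \<eta> k) *\<^sub>R riem_grad M (fs (\<mu> k)) (X k)))"
    using assms unfolding ASRGA_run_def by (elim conjE) assumption
  have "0 < \<eta> 0"
    using assms unfolding ASRGA_run_def by (elim conjE) assumption
  show "0 < \<eta> k"
    using step \<open>0 < \<eta> 0\<close> by (cases k) simp_all
  from step[rule_format, of "Suc k"] show "\<mu> (Suc k) = real (Suc k) powr (- 1 / (4 - p))"
    and "(\<eta> (Suc k))\<^sup>2 = (\<eta> k)\<^sup>2
      + \<mu> (Suc k) powr (2 - p) * (norm (riem_grad M (fs (\<mu> (Suc k))) (X (Suc k))))\<^sup>2"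
    and "X (Suc (Suc k)) = R (X (Suc k))
      (- ((\<mu> (Suc k) powr (2 - p) / \<eta> (Suc k)) *\<^sub>R riem_grad M (fs (\<mu> (Suc k))) (X (Suc k))))"
    by simp_all
qed

text \<open>The potential is \<open>fs (\<mu> k) (X k) + C * \<mu> k powr p\<close>; the second summand absorbs the change of the
  smoothing parameter after each step.\<close>

lemma ASRGA_normalization_bounded:
  assumes sub: "\<And>x. x \<in> M \<Longrightarrow> subspace (tangent_space M x)"
    and R: "manifold_retraction M R" and run: "ASRGA_run M R p fs \<mu> \<eta> X"
    and p: "0 < p" "p \<le> 1" and C: "0 \<le> C"
    and bound: "\<And>\<mu> x. 0 < \<mu> \<Longrightarrow> \<mu> \<le> 1 \<Longrightarrow> x \<in> M \<Longrightarrow> \<bar>fs \<mu> x\<bar> \<le> K"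
    and descent: "\<And>\<mu> x v. 0 < \<mu> \<Longrightarrow> \<mu> \<le> 1 \<Longrightarrow> x \<in> M \<Longrightarrow> v \<in> tangent_space M x \<Longrightarrow>
      fs \<mu> (R x v) \<le> fs \<mu> x + v \<bullet> gradient (fs \<mu>) x + \<Lambda> * \<mu> powr (p - 2) * (norm v)\<^sup>2"
    and drift: "\<And>\<mu>\<^sub>1 \<mu>\<^sub>2 x. 0 < \<mu>\<^sub>2 \<Longrightarrow> \<mu>\<^sub>2 \<le> \<mu>\<^sub>1 \<Longrightarrow> fs \<mu>\<^sub>2 x \<le> fs \<mu>\<^sub>1 x + C * (\<mu>\<^sub>1 powr p - \<mu>\<^sub>2 powr p)"
  shows "\<eta> k \<le> max (\<eta> 0) (2 * \<Lambda>) + 4 * (K + C)"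
proof -
  note step = ASRGA_run_step[OF run] and in_M = ASRGA_run_in_manifold[OF sub R run]
  define G where "G k = riem_grad M (fs (\<mu> k)) (X k)" for k
  define a where "a k = \<mu> k powr (2 - p) * (norm (G k))\<^sup>2" for k
  define F where "F k = fs (\<mu> k) (X k) + C * \<mu> k powr p" for k
  have \<mu>: "0 < \<mu> (Suc k)" "\<mu> (Suc k) \<le> 1" "\<mu> (Suc (Suc k)) \<le> \<mu> (Suc k)" for k
    unfolding step(1) using p powr_mono2'[of "- 1 / (4 - p)" 1 "real (Suc k)"]
    by (auto intro!: powr_mono2')
  show ?thesis
  proof (rule adaptive_normalization_bounded[where a = a and F = F])
    show "0 < \<eta> k" and "0 \<le> a (Suc k)" for k
      using step(2) by (auto simp: a_def)
    show "(\<eta> (Suc k))\<^sup>2 = (\<eta> k)\<^sup>2 + a (Suc k)" for k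
      using step(3) by (simp add: a_def G_def)
    show "\<bar>F (Suc k)\<bar> \<le> K + C" for k
    proof -
      have "\<mu> (Suc k) powr p \<le> 1"
        using \<mu>[of k] p by (intro powr_le1) auto
      then have "C * \<mu> (Suc k) powr p \<le> C" "0 \<le> C * \<mu> (Suc k) powr p"
        using C by (auto intro: mult_left_le)
      then show ?thesis
        using bound[OF \<mu>(1,2) in_M, of k "Suc k"] unfolding F_def by linarith
    qed
    fix k
    let ?m = "\<mu> (Suc k)" and ?e = "\<eta> (Suc k)" and ?x = "X (Suc k)" and ?G = "G (Suc k)"
    let ?s = "?m powr (2 - p) / ?e"
    let ?v = "- (?s *\<^sub>R ?G)"
    have sub': "subspace (tangent_space M ?x)"
      by (rule sub[OF in_M])
    have v: "?v \<in> tangent_space M ?x"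
      unfolding G_def using sub' by (simp add: riem_grad_tangent(1) subspace_neg subspace_scale)
    have "fs ?m (X (Suc (Suc k)))
        \<le> fs ?m ?x + ?v \<bullet> gradient (fs ?m) ?x + \<Lambda> * ?m powr (p - 2) * (norm ?v)\<^sup>2"
      using descent[OF \<mu>(1,2) in_M v] step(4)[of k] by (simp add: G_def)
    also have "?v \<bullet> gradient (fs ?m) ?x = - (a (Suc k) / ?e)"
      using riem_grad_tangent(2)[OF sub', of "fs ?m"] by (simp add: G_def a_def)
    also have "\<Lambda> * ?m powr (p - 2) * (norm ?v)\<^sup>2 = \<Lambda> * (a (Suc k) / ?e\<^sup>2)"
    proof -
      have "?m powr (p - 2) * (?m powr (2 - p))\<^sup>2 = ?m powr (2 - p)"
        using \<mu>(1)[of k] by (simp add: power2_eq_square flip: powr_add)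
      then have "?m powr (p - 2) * (norm ?v)\<^sup>2 = a (Suc k) / ?e\<^sup>2"
        by (simp add: a_def power_mult_distrib power_divide flip: mult.assoc)
      then show ?thesis by (simp add: mult.assoc)
    qed
    finally have "fs ?m (X (Suc (Suc k))) \<le> fs ?m ?x - a (Suc k) / ?e + \<Lambda> * (a (Suc k) / ?e\<^sup>2)"
      by simp
    then show "F (Suc (Suc k)) \<le> F (Suc k) - a (Suc k) / ?e + \<Lambda> * (a (Suc k) / ?e\<^sup>2)"
      using drift[OF \<mu>(1) \<mu>(3), of k "X (Suc (Suc k))"] unfolding F_def by (simp add: algebra_simps)
  qed
qed

text \<open>The squared gradient norms, weighted by \<open>\<mu> j powr (2 - p) = j powr (- r)\<close>, sum to at most \<open>E\<^sup>2\<close>.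
  The window from \<open>k div 2\<close> to \<open>k\<close> contributes at least \<open>k / 2\<close> times \<open>k powr (- r)\<close> times the
  smallest squared norm, and \<open>1 - r = 2 / (4 - p)\<close>. From \<open>k = 2\<close> on the window avoids the index \<open>0\<close>,
  whose smoothing parameter is part of the input.\<close>

lemma ASRGA_best_gradient_rate:
  assumes run: "ASRGA_run M R p fs \<mu> \<eta> X" and best: "best_index M fs \<mu> X N"
    and p: "0 < p" "p \<le> 1" and E: "\<And>k. \<eta> k \<le> E" and k: "2 \<le> k"
  shows "norm (riem_grad M (fs (\<mu> (N k))) (X (N k))) \<le> 2 * E * real k powr (- 1 / (4 - p))"
proof -
  note step = ASRGA_run_step[OF run]
  define G where "G j = norm (riem_grad M (fs (\<mu> j)) (X j))" for j
  define r where "r = (2 - p) / (4 - p)"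
  have \<mu>_powr: "\<mu> j powr (2 - p) = real j powr (- r)" if "1 \<le> j" for j
    using step(1)[of "j - 1"] that by (simp add: powr_powr r_def)
  have sum_eq: "(\<Sum>j=1..n. real j powr (- r) * (G j)\<^sup>2) = (\<eta> n)\<^sup>2 - (\<eta> 0)\<^sup>2" for n
  proof (induction n)
    case (Suc n)
    then show ?case
      using step(3)[of n] \<mu>_powr[of "Suc n"] by (simp add: G_def)
  qed simp
  have E0: "0 \<le> E"
    using E[of 0] step(2)[of 0] by linarith
  have min: "G (N k) \<le> G j" if "j \<in> {k div 2..k}" for j
    using best k that unfolding best_index_def is_arg_min_def G_def by (meson linorder_not_less order_trans one_le_numeral)
  have "real k / 2 * (real k powr (- r) * (G (N k))\<^sup>2)
      \<le> real (card {k div 2..k}) * (real k powr (- r) * (G (N k))\<^sup>2)"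
    by (intro mult_right_mono) auto
  also have "\<dots> \<le> (\<Sum>j\<in>{k div 2..k}. real j powr (- r) * (G j)\<^sup>2)"
  proof (rule sum_bounded_below)
    fix j assume j: "j \<in> {k div 2..k}"
    then have "1 \<le> j" using k by auto
    then have "real k powr (- r) \<le> real j powr (- r)"
      using j p by (intro powr_mono2') (auto simp: r_def)
    moreover have "(G (N k))\<^sup>2 \<le> (G j)\<^sup>2"
      using min[OF j] by (intro power_mono) (auto simp: G_def)
    ultimately show "real k powr (- r) * (G (N k))\<^sup>2 \<le> real j powr (- r) * (G j)\<^sup>2"
      by (intro mult_mono) auto
  qed
  also have "\<dots> \<le> (\<Sum>j=1..k. real j powr (- r) * (G j)\<^sup>2)"
    using k by (intro sum_mono2) auto
  also have "\<dots> \<le> (\<eta> k)\<^sup>2"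
    using sum_eq[of k] by simp
  also have "\<dots> \<le> E\<^sup>2"
    using E[of k] step(2)[of k] by (intro power_mono) auto
  finally have main: "real k * real k powr (- r) * (G (N k))\<^sup>2 \<le> 2 * E\<^sup>2"
    by simp
  \<comment> \<open>The exponent of the smoothing parameters is the one for which \<open>w\<^sup>2\<close> is exactly the reciprocal of
    the factor \<open>k * k powr (- r)\<close> just obtained.\<close>
  define w where "w = real k powr (- 1 / (4 - p))"
  have "real k * real k powr (- r) * w\<^sup>2 = real k powr (1 + - r + (- 1 / (4 - p) + - 1 / (4 - p)))"
    unfolding powr_add w_def power2_eq_square using k by simp
  also have "1 + - r + (- 1 / (4 - p) + - 1 / (4 - p)) = 0"
    using p by (simp add: r_def field_simps)
  finally have w: "real k * real k powr (- r) * w\<^sup>2 = 1"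
    using k by simp
  have "(G (N k))\<^sup>2 = (real k * real k powr (- r) * (G (N k))\<^sup>2) * w\<^sup>2"
    using w by (simp add: mult_ac)
  also have "\<dots> \<le> (2 * E\<^sup>2) * w\<^sup>2"
    using main by (intro mult_right_mono) auto
  also have "\<dots> \<le> (2 * E * w)\<^sup>2"
    by (simp add: power_mult_distrib mult_right_mono)
  finally have "(G (N k))\<^sup>2 \<le> (2 * E * w)\<^sup>2" .
  then have "G (N k) \<le> 2 * E * w"
    by (rule power2_le_imp_le) (use E0 in \<open>simp add: w_def\<close>)
  then show ?thesis
    by (simp add: G_def w_def)
qed

section \<open>Stationarity and iteration count\<close>

lemma scaled_powr_le:
  fixes A x \<epsilon> p :: real
  assumes "0 < A" and "0 < \<epsilon>" and "p < 4" and "A powr (4 - p) * \<epsilon> powr (p - 4) \<le> x"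
  shows "A * x powr (- 1 / (4 - p)) \<le> \<epsilon>"
proof -
  let ?y = "(A / \<epsilon>) powr (4 - p)"
  have y: "?y = A powr (4 - p) * \<epsilon> powr (p - 4)"
    using assms powr_minus_divide[of \<epsilon> "4 - p"] by (simp add: powr_divide)
  have "0 < ?y"
    using assms by simp
  then have "x powr (- 1 / (4 - p)) \<le> ?y powr (- 1 / (4 - p))"
    using assms y by (intro powr_mono2') auto
  also have "\<dots> = (A / \<epsilon>) powr (- 1)"
    using assms by (simp add: powr_powr)
  also have "\<dots> = \<epsilon> / A"
    using assms by (simp add: powr_minus)
  finally show ?thesis
    using assms by (simp add: field_simps)
qed

text \<open>With \<open>k\<close> the first integer not below \<open>(3 + A powr (4 - p)) * \<epsilon> powr (p - 4)\<close>, the rate puts the gradient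
  norm at \<open>N k\<close> below \<open>\<epsilon>\<close>. The summand \<open>3\<close> does the same for the smoothing parameter, as
  \<open>N k\<close> is at least \<open>k / 3\<close>; rounding up to an integer turns the \<open>3\<close> into a \<open>4\<close>.\<close>

lemma ASRGA_best_iterate_approx_stationary:
  assumes run: "ASRGA_run M R p fs \<mu> \<eta> X" and best: "best_index M fs \<mu> X N"
    and p: "0 < p" "p \<le> 1" and in_M: "\<And>k. X k \<in> M" and A: "0 < A"
    and rate: "\<And>k. 2 \<le> k \<Longrightarrow>
      norm (riem_grad M (fs (\<mu> (N k))) (X (N k))) \<le> A * real k powr (- 1 / (4 - p))"
    and \<epsilon>: "0 < \<epsilon>" "\<epsilon> \<le> 1"
  shows "\<exists>j\<ge>1. real j \<le> (4 + A powr (4 - p)) * \<epsilon> powr (p - 4) \<and> approx_stationary_point M fs \<epsilon> (X j)"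
proof -
  let ?T = "\<epsilon> powr (p - 4)"
  have T: "1 \<le> ?T"
    using powr_mono2'[of "p - 4" \<epsilon> 1] \<epsilon> p by simp
  define c where "c = 3 + A powr (4 - p)"
  have c: "3 \<le> c" "A powr (4 - p) \<le> c" by (simp_all add: c_def)
  define k where "k = nat \<lceil>c * ?T\<rceil>"
  have k_ge: "c * ?T \<le> real k"
    unfolding k_def by (rule real_nat_ceiling_ge)
  have cT: "3 * ?T \<le> c * ?T" "A powr (4 - p) * ?T \<le> c * ?T"
    using c by (auto intro: mult_right_mono)
  have "3 \<le> real k"
    using cT(1) T k_ge by linarith
  then have k2: "2 \<le> k" by simp
  have "real k \<le> c * ?T + 1"
  proof -
    have "0 \<le> c * ?T"
      using cT(1) T by linarith
    then have "real k = of_int \<lceil>c * ?T\<rceil>"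
      unfolding k_def by (intro of_nat_nat) simp
    then show ?thesis
      using of_int_ceiling_le_add_one[of "c * ?T"] by simp
  qed
  also have "\<dots> \<le> (4 + A powr (4 - p)) * ?T"
    using T by (simp add: c_def algebra_simps)
  finally have k_le: "real k \<le> (4 + A powr (4 - p)) * ?T" .
  have N: "N k \<in> {k div 2..k}"
    using best k2 unfolding best_index_def is_arg_min_def by simp
  then have "1 \<le> N k" "k \<le> 3 * N k" "N k \<le> k"
    using k2 by (simp_all, linarith+)
  then have N1: "1 \<le> N k" "real k \<le> 3 * real (N k)" "N k \<le> k"
    by simp_all
  have \<mu>N: "\<mu> (N k) = real (N k) powr (- 1 / (4 - p))"
    using ASRGA_run_step(1)[OF run, of "N k - 1"] N1(1) by simp
  have "1 powr (4 - p) * ?T \<le> real (N k)"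
    using cT(1) k_ge N1(2) by simp
  then have "1 * real (N k) powr (- 1 / (4 - p)) \<le> \<epsilon>"
    using \<epsilon> p by (intro scaled_powr_le) auto
  then have "\<mu> (N k) \<le> \<epsilon>" "0 < \<mu> (N k)"
    unfolding \<mu>N using N1(1) by auto
  moreover have "norm (riem_grad M (fs (\<mu> (N k))) (X (N k))) \<le> \<epsilon>"
    using rate[OF k2] scaled_powr_le[OF A \<epsilon>(1), of p "real k"] cT(2) k_ge p by linarith
  ultimately have "approx_stationary_point M fs \<epsilon> (X (N k))"
    unfolding approx_stationary_point_def using in_M by blast
  then show ?thesis
    using N1 k_le by (intro exI[of _ "N k"]) auto
qed

text \<open>A subsequence of the best iterates that converges to \<open>x\<close>, together with its smoothing parameters,
  is itself a witness that \<open>0\<close> lies in the subdifferential at \<open>x\<close>.\<close>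

lemma ASRGA_accumulation_point_stationary:
  fixes M :: "'a::euclidean_space set"
  assumes run: "ASRGA_run M R p fs \<mu> \<eta> X" and best: "best_index M fs \<mu> X N"
    and p: "0 < p" "p \<le> 1" and M: "compact M"
    and sub: "\<And>x. x \<in> M \<Longrightarrow> subspace (tangent_space M x)" and in_M: "\<And>k. X k \<in> M"
    and rate: "\<And>k. 2 \<le> k \<Longrightarrow>
      norm (riem_grad M (fs (\<mu> (N k))) (X (N k))) \<le> A * real k powr (- 1 / (4 - p))"
    and acc: "accumulation_point (\<lambda>k. X (N k)) x"
  shows "stationary_point M fs x"
proof -
  obtain r where r: "strict_mono r" "(\<lambda>k. X (N (r k))) \<longlonglongrightarrow> x"
    using acc unfolding accumulation_point_def o_def by blast
  have x: "x \<in> M"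
    using closed_sequentially[OF compact_imp_closed[OF M] _ r(2)] in_M by blast
  have N_ge: "k div 2 \<le> N k" if "1 \<le> k" for k
    using best that unfolding best_index_def is_arg_min_def by auto
  have r_top: "filterlim r at_top sequentially"
    using r(1) by (rule filterlim_subseq)
  have div_top: "filterlim (\<lambda>k::nat. k div 2) at_top sequentially"
    unfolding filterlim_at_top eventually_sequentially by (metis add_leD2 div_mult_self1_is_m
        div_le_mono mult_2 zero_less_numeral)
  have N_top: "filterlim N at_top sequentially"
    by (rule filterlim_at_top_mono[OF div_top])
      (use N_ge in \<open>auto simp: eventually_sequentially\<close>)
  have null: "(\<lambda>k. real k powr (- 1 / (4 - p))) \<longlonglongrightarrow> 0"
    using p by (intro tendsto_neg_powr filterlim_real_sequentially) auto
  have \<mu>_pos: "0 < \<mu> k" for k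
    using ASRGA_run_step(1)[OF run, of "k - 1"] run by (cases k) (auto simp: ASRGA_run_def)
  have "\<mu> \<longlonglongrightarrow> 0"
    by (rule Lim_transform_eventually[OF null])
      (use ASRGA_run_step(1)[OF run] in \<open>auto simp: eventually_sequentially intro!: exI[of _ 1] dest!: Suc_le_D\<close>)
  then have "(\<lambda>k. \<mu> (N (r k))) \<longlonglongrightarrow> 0"
    using filterlim_compose[OF filterlim_compose[OF _ N_top] r_top] by blast
  then have \<mu>: "filterlim (\<lambda>k. \<mu> (N (r k))) (at_right 0) sequentially"
    unfolding filterlim_at using \<mu>_pos by (simp add: less_imp_neq[symmetric])
  have "(\<lambda>k. A * real k powr (- 1 / (4 - p))) \<longlonglongrightarrow> 0"
    using tendsto_mult_right_zero[OF null] .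
  then have "(\<lambda>k. riem_grad M (fs (\<mu> (N k))) (X (N k))) \<longlonglongrightarrow> 0"
    by (rule Lim_null_comparison[rotated])
      (use rate in \<open>auto simp: eventually_sequentially\<close>)
  then have "(\<lambda>k. riem_grad M (fs (\<mu> (N (r k)))) (X (N (r k)))) \<longlonglongrightarrow> 0"
    using filterlim_compose[OF _ r_top] by blast
  then have "\<exists>Z u. (\<forall>k. Z k \<in> M) \<and> Z \<longlonglongrightarrow> x \<and> filterlim u (at_right 0) sequentially \<and>
      (\<lambda>k::nat. riem_grad M (fs (u k)) (Z k)) \<longlonglongrightarrow> 0"
    using r(2) \<mu> in_M
    by (intro exI[of _ "\<lambda>k. X (N (r k))"] exI[of _ "\<lambda>k. \<mu> (N (r k))"]) simp
  then have "0 \<in> riem_subdifferential M fs x"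
    unfolding riem_subdifferential_def using subspace_0[OF sub[OF x]] by simp
  then show ?thesis
    unfolding stationary_point_def using x by blast
qed

theorem theorem5p4:
  fixes M :: "(real^'s^'n) set"
    and g :: "real^'s^'n \<Rightarrow> real"
    and h :: "nat \<Rightarrow> real^'s^'n \<Rightarrow> real"
    and m :: nat
    and p L\<^sub>g L\<^sub>h :: real
    and \<phi> :: "real \<Rightarrow> real"
    and \<phi>s :: "real \<Rightarrow> real \<Rightarrow> real"
    and R :: "real^'s^'n \<Rightarrow> real^'s^'n \<Rightarrow> real^'s^'n"
    and \<mu> \<eta> :: "nat \<Rightarrow> real"
    and X :: "nat \<Rightarrow> real^'s^'n"
    and N :: "nat \<Rightarrow> nat"
  assumes "1 \<le> m" and "0 < p" and "p \<le> 1"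
    and "compact M" and "embedded_submanifold M"
    and "\<And>x. g differentiable (at x)" and "continuous_on UNIV (gradient g)"
    and "\<And>i x. i \<in> {1..m} \<Longrightarrow> h i differentiable (at x)"
    and "\<And>i. i \<in> {1..m} \<Longrightarrow> continuous_on UNIV (gradient (h i))"
    and "L\<^sub>g-lipschitz_on M (gradient g)"
    and "\<And>i. i \<in> {1..m} \<Longrightarrow> L\<^sub>h-lipschitz_on M (gradient (h i))"
    and "\<And>t. 0 \<le> \<phi> t" and "\<And>t. \<exists>u>0. \<exists>L. L-lipschitz_on (cball t u) \<phi>"
    and "smoothing_function \<phi> \<phi>s"
    and "manifold_retraction M R"
    and "ASRGA_run M R p (smoothed_objective g h m p \<phi>s) \<mu> \<eta> X"
    and "best_index M (smoothed_objective g h m p \<phi>s) \<mu> X N"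
  shows "((\<exists>x. accumulation_point (\<lambda>k. X (N k)) x) \<and>
         (\<forall>x. accumulation_point (\<lambda>k. X (N k)) x \<longrightarrow>
              stationary_point M (smoothed_objective g h m p \<phi>s) x)) \<and>
         (\<exists>C>0. \<exists>\<epsilon>0>0. \<forall>\<epsilon>. 0 < \<epsilon> \<and> \<epsilon> \<le> \<epsilon>0 \<longrightarrow>
           (\<exists>j\<ge>1. real j \<le> C * \<epsilon> powr (p - 4) \<and>
              approx_stationary_point M (smoothed_objective g h m p \<phi>s) \<epsilon> (X j)))"
proof -
  let ?fs = "smoothed_objective g h m p \<phi>s"
  note p = \<open>0 < p\<close> \<open>p \<le> 1\<close> and M = \<open>compact M\<close> and sm = \<open>smoothing_function \<phi> \<phi>s\<close>
    and R = \<open>manifold_retraction M R\<close> and run = \<open>ASRGA_run M R p ?fs \<mu> \<eta> X\<close>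
    and best = \<open>best_index M ?fs \<mu> X N\<close>
  note sub = subspace_tangent_space[OF \<open>embedded_submanifold M\<close>]
  have in_M: "X k \<in> M" for k
    by (rule ASRGA_run_in_manifold[OF _ R run]) (rule sub)
  obtain K where K: "0 < K"
    and fs: "\<And>\<mu> x. 0 < \<mu> \<Longrightarrow> \<mu> \<le> 1 \<Longrightarrow> x \<in> M \<Longrightarrow> \<bar>?fs \<mu> x\<bar> \<le> K"
    and grad: "\<And>\<mu> x. 0 < \<mu> \<Longrightarrow> \<mu> \<le> 1 \<Longrightarrow> x \<in> M \<Longrightarrow> norm (gradient (?fs \<mu>) x) \<le> K * \<mu> powr (p - 2)"
    and lip: "\<And>\<mu>. 0 < \<mu> \<Longrightarrow> \<mu> \<le> 1 \<Longrightarrow> (K * \<mu> powr (p - 2))-lipschitz_on M (gradient (?fs \<mu>))"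
    by (rule smoothed_objective_bounds[where m = m and h = h, OF sm p M assms(6-11)]) (assumption | (rule that; assumption))+
  obtain A where A: "0 < A"
    and descent: "\<And>f f' K. K-lipschitz_on M f' \<Longrightarrow>
      \<forall>y\<in>M. GDERIV f y :> f' y \<and> \<bar>f y\<bar> \<le> K \<and> norm (f' y) \<le> K \<Longrightarrow>
      \<forall>x\<in>M. \<forall>v\<in>tangent_space M x. f (R x v) \<le> f x + v \<bullet> f' x + A * K * (norm v)\<^sup>2"
    by (rule retraction_descent[OF M sub R]) (assumption | (rule that; assumption))+
  obtain C where C: "0 \<le> C"
    and drift: "\<And>\<mu>\<^sub>1 \<mu>\<^sub>2 x. 0 < \<mu>\<^sub>2 \<Longrightarrow> \<mu>\<^sub>2 \<le> \<mu>\<^sub>1 \<Longrightarrow>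
      ?fs \<mu>\<^sub>2 x \<le> ?fs \<mu>\<^sub>1 x + C * (\<mu>\<^sub>1 powr p - \<mu>\<^sub>2 powr p)"
    by (rule smoothed_objective_parameter_drift[OF sm p, of g h m]) (assumption | (rule that; assumption))+
  have step: "?fs \<mu> (R x v) \<le> ?fs \<mu> x + v \<bullet> gradient (?fs \<mu>) x + (A * K) * \<mu> powr (p - 2) * (norm v)\<^sup>2"
    if \<mu>: "0 < \<mu>" "\<mu> \<le> 1" and x: "x \<in> M" "v \<in> tangent_space M x" for \<mu> x v
  proof -
    have "1 \<le> \<mu> powr (p - 2)"
      using powr_mono2'[of "p - 2" \<mu> 1] \<mu> p by simp
    then have "K \<le> K * \<mu> powr (p - 2)"
      using K by simp
    have "GDERIV (?fs \<mu>) y :> gradient (?fs \<mu>) y" for y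
    proof -
      have D: "GDERIV (?fs \<mu>) y :>
          (gradient g y + (\<Sum>i=1..m. powr_smoothing_deriv p \<phi>s \<mu> (h i y) *\<^sub>R gradient (h i) y))"
        by (rule smoothed_objective_GDERIV[OF sm \<mu>(1) assms(6)]) (rule assms(8))
      show ?thesis
        unfolding gradient_eq[OF D] by (rule D)
    qed
    moreover have "\<bar>?fs \<mu> y\<bar> \<le> K * \<mu> powr (p - 2)" if "y \<in> M" for y
      using fs[OF \<mu> that] \<open>K \<le> K * \<mu> powr (p - 2)\<close> by linarith
    ultimately have "\<forall>y\<in>M. GDERIV (?fs \<mu>) y :> gradient (?fs \<mu>) y \<and>
        \<bar>?fs \<mu> y\<bar> \<le> K * \<mu> powr (p - 2) \<and> norm (gradient (?fs \<mu>) y) \<le> K * \<mu> powr (p - 2)"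
      using grad[OF \<mu>] by simp
    from descent[OF lip[OF \<mu>] this] x
    have "?fs \<mu> (R x v) \<le> ?fs \<mu> x + v \<bullet> gradient (?fs \<mu>) x + A * (K * \<mu> powr (p - 2)) * (norm v)\<^sup>2"
      by blast
    then show ?thesis
      by (simp add: mult.assoc)
  qed
  define E where "E = max (\<eta> 0) (2 * (A * K)) + 4 * (K + C)"
  have E: "\<eta> k \<le> E" for k
    unfolding E_def by (rule ASRGA_normalization_bounded[OF sub R run p C fs step drift])
  have "0 < E"
    using E[of 0] ASRGA_run_step(2)[OF run, of 0] by linarith
  then have E2: "0 < 2 * E" by simp
  note rate = ASRGA_best_gradient_rate[OF run best p E]
  show ?thesis
  proof (intro conjI allI impI)
    show "\<exists>x. accumulation_point (\<lambda>k. X (N k)) x"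
      using seq_compactE[OF compact_imp_seq_compact[OF M], of "\<lambda>k. X (N k)"] in_M
      unfolding accumulation_point_def by metis
    show "stationary_point M ?fs x" if "accumulation_point (\<lambda>k. X (N k)) x" for x
      by (rule ASRGA_accumulation_point_stationary[OF run best p M _ in_M rate that]) (rule sub)
    have "\<exists>j\<ge>1. real j \<le> (4 + (2 * E) powr (4 - p)) * \<epsilon> powr (p - 4) \<and>
        approx_stationary_point M ?fs \<epsilon> (X j)" if "0 < \<epsilon>" "\<epsilon> \<le> 1" for \<epsilon>
      by (rule ASRGA_best_iterate_approx_stationary[OF run best p in_M E2 rate that])
    moreover have "0 < 4 + (2 * E) powr (4 - p)"
      by (simp add: add_pos_nonneg)
    ultimately show "\<exists>C>0. \<exists>\<epsilon>0>0. \<forall>\<epsilon>. 0 < \<epsilon> \<and> \<epsilon> \<le> \<epsilon>0 \<longrightarrow>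
           (\<exists>j\<ge>1. real j \<le> C * \<epsilon> powr (p - 4) \<and> approx_stationary_point M ?fs \<epsilon> (X j))"
      using zero_less_one by blast
  qed
qed

end
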